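(* Let $m>1$ and $r>0$ be fixed. For each integer $d\ge 3$ set $\alpha=\alpha_d:=\frac{1}{2-d(1-m)}$, and for $x_0\in\mathbb{R}^d$ let $v(t,\cdot)$, $t>0$, be the solution in $\mathbb{R}^d$ of $\partial_t v=\Delta(v^m)+\mathrm{div}(xv)$ with initial condition $v(0,\cdot)=\delta_{x_0}$, and let $v_\infty$ be its long-time limit (explicit formulas for both are given in the context). Then for every choice of $\mathrm{dist}(\cdot,\cdot)\in\{\mathrm{W}_2^2(\cdot,\cdot),\ \mathrm{H}_m(\cdot\mid\cdot),\ \mathrm{I}_m(\cdot\mid\cdot)\}$: (i) for every $\varepsilon\in(0,1)$, with $t_d=(1-\varepsilon)\frac12\log(d)$, $$\lim_{d\to\infty}\ \sup_{x_0\in\mathbb{R}^d,\ |x_0|\le r\sqrt d}\mathrm{dist}(v(t_d,\cdot),v_\infty)=+\infty;$$ (ii) for every $\varepsilon>0$, with $t_d=(1+\varepsilon)\frac12\log(d)$, $$\lim_{d\to\infty}\ \sup_{x_0\in\mathbb{R}^d,\ |x_0|\le r\sqrt d}\mathrm{dist}(v(t_d,\cdot),v_\infty)=0.$$ In particular, the cutoff critical time is of order $\log(d)$.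
   Context: $|\cdot|$ is the Euclidean norm and $(\cdot)_+$ the positive part. The Barenblatt profile is $$B(x)=\Big(c+\alpha\tfrac{1-m}{2m}|x|^2\Big)_+^{\frac1{m-1}},\qquad x\in\mathbb{R}^d,\qquad \alpha=\frac{1}{2-d(1-m)}>0,$$ where $c=c_{d,m}>0$ is the constant making $B$ a probability density on $\mathbb{R}^d$. The solution with initial condition $\delta_{x_0}$ is, for $t>0$, $$v(t,x)=\frac{1}{(\alpha(1-\mathrm{e}^{-t/\alpha}))^{\alpha d}}\,B\Big(\frac{x-\mathrm{e}^{-t}x_0}{(\alpha(1-\mathrm{e}^{-t/\alpha}))^{\alpha}}\Big),$$ and its long-time limit is $$v_\infty(x)=\frac{1}{\alpha^{\alpha d}}B\Big(\frac{x}{\alpha^\alpha}\Big)=\Big(C+\tfrac{1-m}{2m}|x|^2\Big)_+^{\frac1{m-1}}$$ for a constant $C>0$ depending on $d,m$. Probability densities are identified with the corresponding probability measures. All of $v$, $v_\infty$, $x_0$, $\alpha$ and $\mathrm{dist}$ depend on $d$. The distances and divergences are as follows. $\mathrm{W}_2(\mu,\nu)=\sqrt{\inf_\pi\int|x-y|^2\,\mathrm{d}\pi(x,y)}$, the infimum being over probability measures on $\mathbb{R}^d\times\mathbb{R}^d$ with marginals $\mu$ and $\nu$. The relative entropy is $$\mathrm{H}_m(f\mid v_\infty)=\frac{1}{m-1}\int_{\mathbb{R}^d}\Big(f(x)^m-v_\infty(x)^m-\tfrac{1-m}{2}|x|^2(f(x)-v_\infty(x))\Big)\mathrm{d}x.$$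 The Fisher information is $$\mathrm{I}_m(f\mid v_\infty)=\int_{\mathbb{R}^d} f\,\Big|x+\tfrac{m}{m-1}\nabla f^{m-1}\Big|^2\mathrm{d}x,$$ where, for compactly supported $f$, $\nabla f^{m-1}$ is taken to be $0$ where $f=0$. *)

theory Defs
  imports "HOL-Probability.Probability"
begin

text \<open>
  The dimension d varies, so points of Euclidean d-space are extensional functions in
  \<^term>\<open>PiE {..<d} (\<lambda>_. UNIV)\<close>, with coordinates indexed by 0, ..., d - 1.
\<close>

definition lebR :: "nat \<Rightarrow> (nat \<Rightarrow> real) measure" where
  "lebR d = PiM {..<d} (\<lambda>_. lborel)"

definition enorm :: "nat \<Rightarrow> (nat \<Rightarrow> real) \<Rightarrow> real" where
  "enorm d x = L2_set x {..<d}"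

definition alpha :: "real \<Rightarrow> nat \<Rightarrow> real" where
  "alpha m d = 1 / (2 - real d * (1 - m))"

definition profile :: "real \<Rightarrow> nat \<Rightarrow> real \<Rightarrow> (nat \<Rightarrow> real) \<Rightarrow> real" where
  "profile m d c x =
     max 0 (c + alpha m d * ((1 - m) / (2 * m)) * (enorm d x)\<^sup>2) powr (1 / (m - 1))"

definition barenblatt_const :: "real \<Rightarrow> nat \<Rightarrow> real" where
  "barenblatt_const m d =
     (THE c. c > 0 \<and> (\<integral>\<^sup>+ x. ennreal (profile m d c x) \<partial>lebR d) = 1)"

definition barenblatt :: "real \<Rightarrow> nat \<Rightarrow> (nat \<Rightarrow> real) \<Rightarrow> real" where
  "barenblatt m d = profile m d (barenblatt_const m d)"

text \<open>
  The Barenblatt solution of \<open>\<partial>\<^sub>t v = \<Delta>(v^m) + div (x v)\<close> started from the Dirac mass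
  at \<open>x0\<close>, for \<open>t > 0\<close>, and its limit as \<open>t \<rightarrow> \<infinity>\<close>.
\<close>

definition sol :: "real \<Rightarrow> nat \<Rightarrow> (nat \<Rightarrow> real) \<Rightarrow> real \<Rightarrow> (nat \<Rightarrow> real) \<Rightarrow> real" where
  "sol m d x0 t x =
     (let \<alpha> = alpha m d; \<tau> = \<alpha> * (1 - exp (- t / \<alpha>))
      in 1 / \<tau> powr (\<alpha> * real d) *
         barenblatt m d (\<lambda>i\<in>{..<d}. (x i - exp (- t) * x0 i) / \<tau> powr \<alpha>))"

definition v_inf :: "real \<Rightarrow> nat \<Rightarrow> (nat \<Rightarrow> real) \<Rightarrow> real" where
  "v_inf m d x =
     (let \<alpha> = alpha m d
      in 1 / \<alpha> powr (\<alpha> * real d) * barenblatt m d (\<lambda>i\<in>{..<d}. x i / \<alpha> powr \<alpha>))"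

definition prob_of :: "nat \<Rightarrow> ((nat \<Rightarrow> real) \<Rightarrow> real) \<Rightarrow> (nat \<Rightarrow> real) measure" where
  "prob_of d f = density (lebR d) (\<lambda>x. ennreal (f x))"

definition couplings :: "'a measure \<Rightarrow> 'b measure \<Rightarrow> ('a \<times> 'b) measure set" where
  "couplings \<mu> \<nu> = {\<pi>. prob_space \<pi> \<and> sets \<pi> = sets (\<mu> \<Otimes>\<^sub>M \<nu>) \<and>
                       distr \<pi> \<mu> fst = \<mu> \<and> distr \<pi> \<nu> snd = \<nu>}"

definition ennsqrt :: "ennreal \<Rightarrow> ennreal" where
  "ennsqrt a = (if a = \<infinity> then \<infinity> else ennreal (sqrt (enn2real a)))"

definition W2 :: "nat \<Rightarrow> (nat \<Rightarrow> real) measure \<Rightarrow> (nat \<Rightarrow> real) measure \<Rightarrow> ennreal" where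
  "W2 d \<mu> \<nu> = ennsqrt (INF \<pi> \<in> couplings \<mu> \<nu>.
                  \<integral>\<^sup>+ z. ennreal ((enorm d (\<lambda>i\<in>{..<d}. fst z i - snd z i))\<^sup>2) \<partial>\<pi>)"

definition W2_sq :: "real \<Rightarrow> nat \<Rightarrow> ((nat \<Rightarrow> real) \<Rightarrow> real) \<Rightarrow> ereal" where
  "W2_sq m d f = enn2ereal ((W2 d (prob_of d f) (prob_of d (v_inf m d)))\<^sup>2)"

text \<open>
  For \<open>m > 1\<close> and a probability density f, the only part of the integrand that may fail to be
  integrable is the nonnegative \<open>f^m + (m - 1)/2 |x|^2 f\<close>; the integral then diverges to
  \<open>+\<infinity>\<close>.
\<close>

definition rel_entropy :: "real \<Rightarrow> nat \<Rightarrow> ((nat \<Rightarrow> real) \<Rightarrow> real) \<Rightarrow> ereal" where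
  "rel_entropy m d f =
     (let h = (\<lambda>x. f x powr m - v_inf m d x powr m
                   - (1 - m) / 2 * (enorm d x)\<^sup>2 * (f x - v_inf m d x))
      in if integrable (lebR d) h
         then ereal (1 / (m - 1) * (\<integral> x. h x \<partial>lebR d)) else \<infinity>)"

definition partial_deriv :: "nat \<Rightarrow> ((nat \<Rightarrow> real) \<Rightarrow> real) \<Rightarrow> (nat \<Rightarrow> real) \<Rightarrow> real" where
  "partial_deriv i g x = deriv (\<lambda>s. g (x(i := s))) (x i)"

text \<open>
  The gradient is the classical one, which suffices for the densities \<^const>\<open>sol\<close>: they are
  smooth where positive. It is taken to be 0 where f vanishes.
\<close>

definition fisher_info :: "real \<Rightarrow> nat \<Rightarrow> ((nat \<Rightarrow> real) \<Rightarrow> real) \<Rightarrow> ereal" where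
  "fisher_info m d f =
     enn2ereal (\<integral>\<^sup>+ x. ennreal (f x * (enorm d (\<lambda>i\<in>{..<d}. x i + m / (m - 1) *
        (if f x = 0 then 0 else partial_deriv i (\<lambda>y. f y powr (m - 1)) x)))\<^sup>2) \<partial>lebR d)"

end

theory Submission
  imports Defs "HOL-Real_Asymp.Real_Asymp"
begin

text \<open>
  The solution started from a Dirac mass at \<open>x0\<close> is a moved copy of its limit: if Z has the
  stationary law, then the solution at time t is the law of \<open>y + l Z\<close> with
  \<open>y = exp (- t) x0\<close>, \<open>l = (1 - q) powr \<alpha>\<close> and \<open>q = exp (- t / \<alpha>)\<close>
  (lemma \<open>sol_eq_moved\<close>). For such a copy each distance to the stationary law is
  explicit enough, because Z is centred:

    \<^item> the squared Wasserstein distance lies between \<open>|y|\<^sup>2\<close> (the distance of the barycentres)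
      and \<open>|y|\<^sup>2 + (1 - l)\<^sup>2 E |Z|\<^sup>2\<close> (the synchronous coupling);
    \<^item> the relative entropy equals \<open>|y|\<^sup>2 / 2 - (1 - l\<^sup>2) E |Z|\<^sup>2 / 2\<close> plus
      \<open>(l powr (- d (m - 1)) - 1) / (m - 1)\<close> times the expectation of \<open>v powr (m - 1)\<close> at Z,
      where v is the stationary density;
    \<^item> the Fisher information equals \<open>|y|\<^sup>2 + (1 - \<theta>)\<^sup>2 l\<^sup>2 E |Z|\<^sup>2\<close> with
      \<open>\<theta> = 1 / (1 - q)\<close>.

  So every distance is \<open>K |y|\<^sup>2\<close>, with K either 1 or 1/2, up to an error of order q times the
  size of the stationary law. The stationary density is \<open>max 0 (C - \<kappa> |x|\<^sup>2)\<close> to the power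
  \<open>1 / (m - 1)\<close>, with support of squared radius \<open>C / \<kappa>\<close>, and comparing its mass with that on
  a cube gives \<open>C \<le> 2 + \<kappa> d\<close>. Hence that size is linear in d, whereas
  \<open>1 / \<alpha> = 2 + d (m - 1)\<close> makes q smaller than any negative power of d as soon as t is of order
  \<open>ln d\<close>. The error therefore vanishes (\<open>dist_moved_bounds\<close>, \<open>error_tendsto_0\<close>), and
  what is left is the mean: at \<open>t = \<beta> ln d\<close> the supremum of \<open>|y|\<^sup>2\<close> is
  \<open>r\<^sup>2\<close> times \<open>d powr (1 - 2 \<beta>)\<close>, which tends to infinity for \<open>\<beta> < 1/2\<close> and to 0 for
  \<open>\<beta> > 1/2\<close>.
\<close>

section \<open>Affine changes of variables in d-space\<close>

text \<open>Restricting to the first d coordinates keeps the value in the space of \<^const>\<open>lebR\<close>.\<close>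
definition affine_map :: "nat \<Rightarrow> (nat \<Rightarrow> real) \<Rightarrow> real \<Rightarrow> (nat \<Rightarrow> real) \<Rightarrow> nat \<Rightarrow> real" where
  "affine_map d y l z = (\<lambda>i\<in>{..<d}. y i + l * z i)"

lemma enorm_sq: "(enorm d x)\<^sup>2 = (\<Sum>i<d. (x i)\<^sup>2)"
  by (simp add: enorm_def L2_set_def sum_nonneg)

lemma enorm_sq_affine:
  "(enorm d (affine_map d y l z))\<^sup>2
     = (enorm d y)\<^sup>2 + 2 * l * (\<Sum>i<d. y i * z i) + l\<^sup>2 * (enorm d z)\<^sup>2"
proof -
  have "(\<Sum>i<d. (y i + l * z i)\<^sup>2)
      = (\<Sum>i<d. (y i)\<^sup>2 + 2 * l * (y i * z i) + l\<^sup>2 * (z i)\<^sup>2)"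
    by (rule sum.cong) (auto simp: power2_eq_square algebra_simps)
  then show ?thesis
    by (simp add: enorm_sq affine_map_def sum.distrib sum_distrib_left)
qed

lemma measurable_lebR_component [measurable]:
  "i < d \<Longrightarrow> (\<lambda>x. x i) \<in> borel_measurable (lebR d)"
  unfolding lebR_def by measurable

lemma measurable_enorm [measurable]: "enorm d \<in> borel_measurable (lebR d)"
  unfolding enorm_def[abs_def] L2_set_def by measurable

lemma measurable_affine_map [measurable]: "affine_map d y l \<in> measurable (lebR d) (lebR d)"
  unfolding affine_map_def[abs_def]
  apply (subst (2) lebR_def)
  apply (rule measurable_restrict)
  apply simp
  done

lemma lebR_box: "(\<And>i. i < d \<Longrightarrow> A i \<in> sets borel) \<Longrightarrow>
   emeasure (lebR d) (PiE {..<d} A) = (\<Prod>i<d. emeasure lborel (A i))"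
proof -
  interpret product_sigma_finite "\<lambda>_::nat. lborel :: real measure" ..
  assume "\<And>i. i < d \<Longrightarrow> A i \<in> sets borel"
  then show ?thesis unfolding lebR_def by (intro emeasure_PiM) auto
qed

text \<open>A product measure is determined by its values on boxes, and an affine map with one common
  dilation factor acts on a box coordinate by coordinate, so the one-dimensional scaling law
  gives one factor \<open>\<bar>l\<bar>\<close> per coordinate.\<close>
lemma lebR_affine:
  assumes "l \<noteq> 0"
  shows "lebR d = density (distr (lebR d) (lebR d) (affine_map d y l)) (\<lambda>_. ennreal (\<bar>l\<bar> ^ d))"
    (is "_ = ?P")
proof -
  interpret product_sigma_finite "\<lambda>_::nat. lborel :: real measure" ..
  have "?P = PiM {..<d} (\<lambda>_. lborel)"
  proof (rule PiM_eqI)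
    fix A :: "nat \<Rightarrow> real set" assume A: "\<And>i. i \<in> {..<d} \<Longrightarrow> A i \<in> sets lborel"
    have box: "PiE {..<d} A \<in> sets (lebR d)"
      unfolding lebR_def using A by (intro sets_PiM_I_finite) auto
    let ?A = "\<lambda>i. (\<lambda>s. y i + l * s) -` A i"
    have A': "?A i \<in> sets borel" if "i < d" for i
      using measurable_sets[of "\<lambda>s. y i + l * s" borel borel "A i"] A[of i] that by simp
    have one: "emeasure lborel (A i) = ennreal \<bar>l\<bar> * emeasure lborel (?A i)" if "i < d" for i
      using A[of i] that
      by (subst lborel_real_affine[OF assms, of "y i"])
        (auto simp: emeasure_density nn_integral_cmult emeasure_distr nn_integral_distr)
    have "emeasure ?P (PiE {..<d} A)
        = ennreal (\<bar>l\<bar> ^ d) * emeasure (distr (lebR d) (lebR d) (affine_map d y l)) (PiE {..<d} A)"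
      using box by (subst emeasure_density_const) auto
    also have "emeasure (distr (lebR d) (lebR d) (affine_map d y l)) (PiE {..<d} A)
        = emeasure (lebR d) (affine_map d y l -` PiE {..<d} A \<inter> space (lebR d))"
      using box by (simp add: emeasure_distr)
    also have "affine_map d y l -` PiE {..<d} A \<inter> space (lebR d) = PiE {..<d} ?A"
      by (auto simp: affine_map_def lebR_def space_PiM PiE_def Pi_def extensional_def)
    also have "emeasure (lebR d) \<dots> = (\<Prod>i<d. emeasure lborel (?A i))"
      using A' by (rule lebR_box)
    also have "ennreal (\<bar>l\<bar> ^ d) * \<dots> = (\<Prod>i<d. ennreal \<bar>l\<bar> * emeasure lborel (?A i))"
      by (simp add: prod.distrib ennreal_power)
    also have "\<dots> = (\<Prod>i<d. emeasure lborel (A i))"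
      using one by (intro prod.cong) auto
    finally show "emeasure ?P (PiE {..<d} A) = (\<Prod>i<d. emeasure lborel (A i))" .
  qed (auto simp: lebR_def)
  then show ?thesis by (simp add: lebR_def)
qed

lemma nn_integral_lebR_affine:
  assumes "l \<noteq> 0" and [measurable]: "g \<in> borel_measurable (lebR d)"
  shows "(\<integral>\<^sup>+ x. g x \<partial>lebR d) = ennreal (\<bar>l\<bar> ^ d) * (\<integral>\<^sup>+ z. g (affine_map d y l z) \<partial>lebR d)"
  by (subst lebR_affine[OF assms(1), of _ y])
    (simp add: nn_integral_density nn_integral_distr nn_integral_cmult)

lemma affine_map_inverse:
  assumes "l \<noteq> 0" "z \<in> space (lebR d)"
  shows "(\<lambda>i\<in>{..<d}. (affine_map d y l z i - y i) / l) = z"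
  using assms by (auto simp: affine_map_def lebR_def space_PiM PiE_def extensional_def)

text \<open>This turns every integral against a translated and dilated density into an expectation over
  the original law: if Z has density v, then \<open>y + l Z\<close> has density f.\<close>
lemma prob_of_affine:
  assumes "l > 0" and [measurable]: "v \<in> borel_measurable (lebR d)"
    and v0: "\<And>x. 0 \<le> v x"
    and f: "f = (\<lambda>x. v (\<lambda>i\<in>{..<d}. (x i - y i) / l) / l ^ d)"
  shows "f \<in> borel_measurable (lebR d)"
    and "prob_of d f = distr (prob_of d v) (lebR d) (affine_map d y l)"
proof -
  have "(\<lambda>x. (\<lambda>i\<in>{..<d}. (x i - y i) / l)) = affine_map d (\<lambda>i. - y i / l) (1 / l)"
    by (auto simp: affine_map_def diff_divide_distrib fun_eq_iff)
  then have inv: "(\<lambda>x. (\<lambda>i\<in>{..<d}. (x i - y i) / l)) \<in> measurable (lebR d) (lebR d)"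
    by (metis measurable_affine_map)
  show mf: "f \<in> borel_measurable (lebR d)"
    unfolding f using measurable_compose[OF inv assms(2)] by simp
  show "prob_of d f = distr (prob_of d v) (lebR d) (affine_map d y l)"
  proof (rule measure_eqI)
    show "sets (prob_of d f) = sets (distr (prob_of d v) (lebR d) (affine_map d y l))"
      by (simp add: prob_of_def)
    fix A assume "A \<in> sets (prob_of d f)"
    then have A[measurable]: "A \<in> sets (lebR d)" by (simp add: prob_of_def)
    have l: "ennreal (l ^ d) * (ennreal (f (affine_map d y l z)) * h) = ennreal (v z) * h"
      if "z \<in> space (lebR d)" for z h
    proof -
      have "l ^ d * f (affine_map d y l z) = v z"
        using assms(1) affine_map_inverse[of l z d y] that by (simp add: f)
      then show ?thesis using assms(1) v0
        by (metis ennreal_mult' mult.assoc zero_le_power less_imp_le)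
    qed
    have "emeasure (prob_of d f) A = (\<integral>\<^sup>+ x. ennreal (f x) * indicator A x \<partial>lebR d)"
      using mf by (simp add: prob_of_def emeasure_density)
    also have "\<dots> = ennreal (\<bar>l\<bar> ^ d) *
        (\<integral>\<^sup>+ z. ennreal (f (affine_map d y l z)) * indicator A (affine_map d y l z) \<partial>lebR d)"
      using assms(1) mf by (intro nn_integral_lebR_affine) auto
    also have "\<dots> = (\<integral>\<^sup>+ z. ennreal (l ^ d) *
        (ennreal (f (affine_map d y l z)) * indicator A (affine_map d y l z)) \<partial>lebR d)"
      using assms(1) mf by (subst nn_integral_cmult) auto
    also have "\<dots> = (\<integral>\<^sup>+ z. ennreal (v z) * indicator A (affine_map d y l z) \<partial>lebR d)"
      using l by (intro nn_integral_cong) auto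
    also have "\<dots> = (\<integral>\<^sup>+ z. ennreal (v z) * indicator (affine_map d y l -` A \<inter> space (lebR d)) z \<partial>lebR d)"
      by (intro nn_integral_cong) (auto simp: indicator_def)
    also have "\<dots> = emeasure (prob_of d v) (affine_map d y l -` A \<inter> space (lebR d))"
      unfolding prob_of_def by (subst emeasure_density) auto
    also have "\<dots> = emeasure (distr (prob_of d v) (lebR d) (affine_map d y l)) A"
      by (subst emeasure_distr) (auto simp: prob_of_def)
    finally show "emeasure (prob_of d f) A
        = emeasure (distr (prob_of d v) (lebR d) (affine_map d y l)) A" .
  qed
qed

section \<open>Truncated paraboloids\<close>

text \<open>All Barenblatt profiles, with p the exponent \<open>1 / (m - 1)\<close>, k the curvature and c the
  height of the paraboloid.\<close>
definition paraboloid :: "nat \<Rightarrow> real \<Rightarrow> real \<Rightarrow> real \<Rightarrow> (nat \<Rightarrow> real) \<Rightarrow> real" where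
  "paraboloid d p k c x = max 0 (c - k * (enorm d x)\<^sup>2) powr p"

lemma paraboloid_nonneg [simp]: "0 \<le> paraboloid d p k c x"
  by (simp add: paraboloid_def)

lemma measurable_paraboloid [measurable]: "paraboloid d p k c \<in> borel_measurable (lebR d)"
  unfolding paraboloid_def[abs_def] by measurable

lemma emeasure_cube: "0 \<le> h \<Longrightarrow> emeasure (lebR d) (PiE {..<d} (\<lambda>_. {-h..h})) = ennreal ((2 * h) ^ d)"
  by (simp add: lebR_box ennreal_power)

lemma sets_cube [measurable]: "PiE {..<d} (\<lambda>_. {-h..h::real}) \<in> sets (lebR d)"
  unfolding lebR_def by (intro sets_PiM_I_finite) auto

text \<open>The cube inscribed in the ball on which the paraboloid is at least half its height carries at
  least this much mass. Comparing with a cube instead of the ball loses a factor exponential in d, but the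
  resulting height bound is still linear in d, and that is all the cutoff needs.\<close>
lemma paraboloid_mass_lower:
  assumes "d > 0" "p > 0" "k > 0" "c > 0"
  shows "ennreal ((c / 2) powr p * (2 * sqrt (c / (2 * k * real d))) ^ d)
           \<le> (\<integral>\<^sup>+ x. ennreal (paraboloid d p k c x) \<partial>lebR d)"
proof -
  define h where "h = sqrt (c / (2 * k * real d))"
  have h: "h \<ge> 0" "real d * h\<^sup>2 = c / (2 * k)" using assms by (auto simp: h_def)
  let ?Q = "PiE {..<d} (\<lambda>_. {-h..h})"
  have "ennreal ((c / 2) powr p) * indicator ?Q x \<le> ennreal (paraboloid d p k c x)" for x
  proof (cases "x \<in> ?Q")
    case True
    have "(enorm d x)\<^sup>2 \<le> (\<Sum>i<d. h\<^sup>2)"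
      unfolding enorm_sq using True
      by (intro sum_mono) (auto simp: PiE_def Pi_def abs_le_iff intro!: power2_le_iff_abs_le[THEN iffD2])
    then have "k * (enorm d x)\<^sup>2 \<le> c / 2"
      using h(2) assms by (simp add: field_simps)
    then have "(c / 2) powr p \<le> paraboloid d p k c x"
      unfolding paraboloid_def using assms by (intro powr_mono2) auto
    then show ?thesis using True by simp
  qed simp
  then have "(\<integral>\<^sup>+ x. ennreal ((c / 2) powr p) * indicator ?Q x \<partial>lebR d)
      \<le> (\<integral>\<^sup>+ x. ennreal (paraboloid d p k c x) \<partial>lebR d)"
    by (intro nn_integral_mono)
  also have "(\<integral>\<^sup>+ x. ennreal ((c / 2) powr p) * indicator ?Q x \<partial>lebR d)
     = ennreal ((c / 2) powr p * (2 * h) ^ d)"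
    using h by (simp add: nn_integral_cmult_indicator emeasure_cube ennreal_mult)
  finally show ?thesis by (simp add: h_def)
qed

lemma paraboloid_mass_finite:
  assumes "p > 0" "k > 0" "c > 0"
  shows "(\<integral>\<^sup>+ x. ennreal (paraboloid d p k c x) \<partial>lebR d) < \<infinity>"
proof -
  define h where "h = sqrt (c / k)"
  have h: "h \<ge> 0" "h\<^sup>2 = c / k" using assms by (auto simp: h_def)
  let ?Q = "PiE {..<d} (\<lambda>_. {-h..h})"
  have "ennreal (paraboloid d p k c x) \<le> ennreal (c powr p) * indicator ?Q x"
    if x: "x \<in> space (lebR d)" for x
  proof (cases "k * (enorm d x)\<^sup>2 < c")
    case True
    have "x i \<in> {-h..h}" if "i < d" for i
    proof -
      have "(x i)\<^sup>2 \<le> (enorm d x)\<^sup>2"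
        unfolding enorm_sq using that by (intro member_le_sum) auto
      also have "\<dots> \<le> h\<^sup>2"
        using True assms h by (simp add: pos_le_divide_eq mult.commute)
      finally have "\<bar>x i\<bar> \<le> h" using h(1) by (simp add: power2_le_iff_abs_le)
      then show ?thesis by (simp add: abs_le_iff)
    qed
    then have "x \<in> ?Q" using x by (auto simp: lebR_def space_PiM PiE_def)
    moreover have "paraboloid d p k c x \<le> c powr p"
      unfolding paraboloid_def using assms by (intro powr_mono2) auto
    ultimately show ?thesis by (simp add: ennreal_leI)
  next
    case False
    then have "paraboloid d p k c x = 0" by (simp add: paraboloid_def)
    then show ?thesis by simp
  qed
  then have "(\<integral>\<^sup>+ x. ennreal (paraboloid d p k c x) \<partial>lebR d)
      \<le> (\<integral>\<^sup>+ x. ennreal (c powr p) * indicator ?Q x \<partial>lebR d)"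
    by (intro nn_integral_mono) auto
  also have "\<dots> < \<infinity>"
    using h by (simp add: nn_integral_cmult_indicator emeasure_cube ennreal_mult_less_top)
  finally show ?thesis .
qed

text \<open>The substitution \<open>x = sqrt c z\<close> makes all heights comparable: the mass is a strictly
  increasing power of c, which yields existence and uniqueness of the normalising constant.\<close>
lemma paraboloid_mass_scale:
  assumes "c > 0"
  shows "(\<integral>\<^sup>+ x. ennreal (paraboloid d p k c x) \<partial>lebR d)
       = ennreal (c powr (p + real d / 2)) * (\<integral>\<^sup>+ x. ennreal (paraboloid d p k 1 x) \<partial>lebR d)"
proof -
  have *: "paraboloid d p k c (affine_map d (\<lambda>_. 0) (sqrt c) z) = c powr p * paraboloid d p k 1 z" for z
  proof -
    have "max 0 (c - k * (c * (enorm d z)\<^sup>2)) = c * max 0 (1 - k * (enorm d z)\<^sup>2)"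
      using assms by (subst max_mult_distrib_left) (auto simp: algebra_simps)
    moreover have "(c * max 0 (1 - k * (enorm d z)\<^sup>2)) powr p
        = c powr p * max 0 (1 - k * (enorm d z)\<^sup>2) powr p"
      by (rule powr_mult)
    moreover have "(enorm d (\<lambda>_. 0))\<^sup>2 = 0" by (simp add: enorm_sq)
    ultimately show ?thesis using assms
      by (simp add: paraboloid_def enorm_sq_affine)
  qed
  have "sqrt c ^ d = c powr (real d / 2)"
    using assms by (simp add: powr_half_sqrt[symmetric] powr_realpow[symmetric] powr_powr)
  then show ?thesis
    using assms
    by (subst nn_integral_lebR_affine[of "sqrt c" _ _ "\<lambda>_. 0"])
      (auto simp: * ennreal_mult nn_integral_cmult powr_add mult_ac)
qed

text \<open>The normalising constant is a definite description; this is what makes it meaningful.\<close>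
lemma paraboloid_unit_mass:
  assumes "d > 0" "p > 0" "k > 0"
  shows "\<exists>!c. c > 0 \<and> (\<integral>\<^sup>+ x. ennreal (paraboloid d p k c x) \<partial>lebR d) = 1"
proof -
  let ?e = "p + real d / 2"
  have e: "?e > 0" using assms by simp
  obtain w where w: "(\<integral>\<^sup>+ x. ennreal (paraboloid d p k 1 x) \<partial>lebR d) = ennreal w" "w \<ge> 0"
    using paraboloid_mass_finite[of p k 1 d] assms
    by (metis ennreal_cases infinity_ennreal_def less_irrefl zero_less_one)
  have "0 < ennreal ((1 / 2) powr p * (2 * sqrt (1 / (2 * k * real d))) ^ d)"
    using assms by simp
  also have "\<dots> \<le> ennreal w" using paraboloid_mass_lower[of d p k 1] assms w by simp
  finally have w0: "w > 0" by simp
  have eq: "(\<integral>\<^sup>+ x. ennreal (paraboloid d p k c x) \<partial>lebR d) = 1 \<longleftrightarrow> c powr ?e * w = 1"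
    if "c > 0" for c
    using paraboloid_mass_scale[OF that, of d p k] w that
    by (simp add: ennreal_mult[symmetric])
  show ?thesis
  proof (rule ex1I[of _ "(1 / w) powr (1 / ?e)"])
    have "(1 / w) powr (1 / ?e) > 0" using w0 by simp
    then show "0 < (1 / w) powr (1 / ?e) \<and>
      (\<integral>\<^sup>+ x. ennreal (paraboloid d p k ((1 / w) powr (1 / ?e)) x) \<partial>lebR d) = 1"
      using e w0 by (subst eq) (auto simp: powr_powr)
  next
    fix c assume c: "0 < c \<and> (\<integral>\<^sup>+ x. ennreal (paraboloid d p k c x) \<partial>lebR d) = 1"
    then have "c powr ?e = 1 / w" using w0 eq[of c] by (auto simp: field_simps)
    then show "c = (1 / w) powr (1 / ?e)" using e c by (auto simp: powr_powr simp flip: \<open>c powr ?e = 1 / w\<close>)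
  qed
qed

section \<open>Extended nonnegative numbers\<close>

lemma ennsqrt_power2: "(ennsqrt a)\<^sup>2 = a"
proof (cases a)
  case (real r)
  then have "(ennreal (sqrt r))\<^sup>2 = ennreal ((sqrt r)\<^sup>2)" by (intro ennreal_power) simp
  then show ?thesis using real by (simp add: ennsqrt_def)
next
  case top
  then show ?thesis by (simp add: ennsqrt_def power2_eq_square ennreal_mult_top)
qed

lemma ereal_le_enn2ereal: "ennreal x \<le> A \<Longrightarrow> 0 \<le> x \<Longrightarrow> ereal x \<le> enn2ereal A"
  by (simp add: less_eq_ennreal.rep_eq enn2ereal_ennreal)

lemma enn2ereal_le_ereal: "A \<le> ennreal x \<Longrightarrow> 0 \<le> x \<Longrightarrow> enn2ereal A \<le> ereal x"
  by (simp add: less_eq_ennreal.rep_eq enn2ereal_ennreal)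

section \<open>The stationary law\<close>

text \<open>Below, Z denotes a random vector with the stationary law \<open>\<mu>\<close>. The constant C is the height of
  the stationary paraboloid: rescaling space by \<open>a powr a\<close> without loss of mass changes the height of the Barenblatt
  profile by the factor \<open>a powr (2 a - 1)\<close>.\<close>
locale porous_medium =
  fixes m :: real and d :: nat
  assumes m_gt_1: "m > 1" and d_pos: "d > 0"
begin

definition p where "p = 1 / (m - 1)"
definition \<kappa> where "\<kappa> = (m - 1) / (2 * m)"
definition a where "a = alpha m d"
definition C where "C = barenblatt_const m d * a powr (2 * a - 1)"
definition \<mu> where "\<mu> = prob_of d (v_inf m d)"
definition second_moment where "second_moment = (\<integral>z. (enorm d z)\<^sup>2 \<partial>\<mu>)"
text \<open>This is the integral of \<open>v_inf powr m\<close> over d-space.\<close>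
definition inner_energy where "inner_energy = (\<integral>z. v_inf m d z powr (m - 1) \<partial>\<mu>)"
text \<open>The density of \<open>y + l Z\<close>.\<close>
definition moved where
  "moved y l x = v_inf m d (\<lambda>i\<in>{..<d}. (x i - y i) / l) / l ^ d"

lemma p_pos: "p > 0" and kappa_pos: "\<kappa> > 0"
  using m_gt_1 by (auto simp: p_def \<kappa>_def)

lemma inverse_a: "1 / a = 2 + real d * (m - 1)"
  by (simp add: a_def alpha_def algebra_simps)

lemma dm_pos: "real d * (m - 1) > 0"
  using m_gt_1 d_pos by simp

lemma a_pos: "a > 0" and a_le_half: "a \<le> 1 / 2"
proof -
  define X where "X = real d * (m - 1)"
  have eq: "a = 1 / (2 + X)" by (simp add: X_def a_def alpha_def algebra_simps)
  have "X > 0" using dm_pos by (simp add: X_def)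
  then show "a > 0" "a \<le> 1 / 2" unfolding eq by (auto simp: field_simps)
qed

lemma a_dm: "a * real d * (m - 1) = 1 - 2 * a"
proof -
  have "a * (2 + real d * (m - 1)) = 1"
    using inverse_a a_pos by (metis less_irrefl nonzero_eq_divide_eq mult.commute)
  then show ?thesis by (simp add: algebra_simps)
qed

lemma profile_eq: "profile m d c = paraboloid d p (a * \<kappa>) c"
proof -
  have "(1 - m) / (2 * m) = - \<kappa>" by (simp add: \<kappa>_def minus_divide_left)
  then show ?thesis by (simp add: fun_eq_iff profile_def paraboloid_def a_def p_def)
qed

lemma barenblatt_const_mass:
  "barenblatt_const m d > 0" "(\<integral>\<^sup>+ x. ennreal (barenblatt m d x) \<partial>lebR d) = 1"
  using theI'[OF paraboloid_unit_mass[of d p "a * \<kappa>"]] d_pos p_pos kappa_pos a_pos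
  by (auto simp: barenblatt_def barenblatt_const_def profile_eq)

lemma C_pos: "C > 0"
  using barenblatt_const_mass a_pos by (simp add: C_def)

lemma enorm_sq_rescale:
  "l \<noteq> 0 \<Longrightarrow> (enorm d (\<lambda>i\<in>{..<d}. w i / l))\<^sup>2 = (\<Sum>i<d. (w i)\<^sup>2) / l\<^sup>2"
  by (simp add: enorm_sq power_divide sum_divide_distrib)

text \<open>The powers of a cancel because \<open>a d (m - 1) = 1 - 2 a\<close>; this is the mass-preserving
  choice of the similarity exponent.\<close>
lemma v_inf_eq: "v_inf m d x = paraboloid d p \<kappa> C x"
proof -
  let ?c = "barenblatt_const m d" and ?K = "a powr (2 * a - 1)"
  let ?e = "(enorm d x)\<^sup>2"
  have "(enorm d (\<lambda>i\<in>{..<d}. x i / a powr a))\<^sup>2 = ?e / a powr (2 * a)"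
  proof -
    have "(a powr a)\<^sup>2 = a powr (2 * a)" by (simp add: power2_eq_square powr_add[symmetric])
    then show ?thesis using a_pos by (simp add: enorm_sq_rescale) (simp add: enorm_sq)
  qed
  then have "v_inf m d x
      = 1 / a powr (a * real d) * max 0 (?c - a * \<kappa> * (?e / a powr (2 * a))) powr p"
    by (simp add: v_inf_def Let_def a_def[symmetric] barenblatt_def profile_eq paraboloid_def)
  also have "1 / a powr (a * real d) = ?K powr p"
  proof -
    have "a * real d = (1 - 2 * a) * p"
      using a_dm m_gt_1 by (simp add: p_def field_simps)
    then have "1 / a powr (a * real d) = a powr (- ((1 - 2 * a) * p))"
      by (simp add: powr_minus_divide)
    then show ?thesis by (simp add: powr_powr algebra_simps)
  qed
  also have "?K powr p * max 0 (?c - a * \<kappa> * (?e / a powr (2 * a))) powr p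
      = max 0 (?K * (?c - a * \<kappa> * (?e / a powr (2 * a)))) powr p"
  proof -
    have "max 0 (?K * u) = ?K * max 0 u" for u
      using a_pos by (subst max_mult_distrib_left) auto
    then show ?thesis by (simp add: powr_mult)
  qed
  also have "?K * (?c - a * \<kappa> * (?e / a powr (2 * a))) = C - \<kappa> * ?e"
    using a_pos by (simp add: C_def powr_diff field_simps)
  finally show ?thesis by (simp add: paraboloid_def)
qed

lemma measurable_v_inf [measurable]: "v_inf m d \<in> borel_measurable (lebR d)"
  using measurable_paraboloid by (simp add: v_inf_eq[abs_def])

lemma v_inf_nonneg [simp]: "v_inf m d x \<ge> 0"
  by (simp add: v_inf_eq)

lemma sets_mu [measurable_cong, simp]: "sets \<mu> = sets (lebR d)"
  and space_mu [simp]: "space \<mu> = space (lebR d)"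
  by (auto simp: \<mu>_def prob_of_def)

lemma prob_space_mu: "prob_space \<mu>"
proof -
  have B: "barenblatt m d \<in> borel_measurable (lebR d)" "\<And>x. barenblatt m d x \<ge> 0"
    by (simp_all add: barenblatt_def profile_eq)
  have "prob_space (prob_of d (barenblatt m d))"
    using B barenblatt_const_mass
    by (intro prob_spaceI) (simp add: prob_of_def emeasure_density)
  moreover have "v_inf m d = (\<lambda>x. barenblatt m d (\<lambda>i\<in>{..<d}. (x i - 0) / a powr a) / (a powr a) ^ d)"
    using a_pos
    by (simp add: fun_eq_iff v_inf_def Let_def a_def[symmetric] powr_realpow[symmetric] powr_powr)
  then have "\<mu> = distr (prob_of d (barenblatt m d)) (lebR d) (affine_map d (\<lambda>_. 0) (a powr a))"
    unfolding \<mu>_def using prob_of_affine(2)[of "a powr a" "barenblatt m d" d "v_inf m d" "\<lambda>_. 0"] B a_pos by simp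
  ultimately show ?thesis
    by (auto intro!: prob_space.prob_space_distr simp: prob_of_def)
qed

sublocale mu: prob_space \<mu> by (rule prob_space_mu)

lemma measure_mu_space [simp]: "measure \<mu> (space (lebR d)) = 1"
  using mu.prob_space by simp

text \<open>A paraboloid higher than this would, by comparison with the inscribed cube, have mass greater
  than one.\<close>
lemma C_le: "C \<le> 2 + \<kappa> * real d"
proof (rule ccontr)
  assume "\<not> ?thesis"
  moreover have "0 < \<kappa> * real d" using kappa_pos d_pos by simp
  ultimately have big: "C > 2" "C > \<kappa> * real d" by linarith+
  have "(\<integral>\<^sup>+ x. ennreal (paraboloid d p \<kappa> C x) \<partial>lebR d) = 1"
    using mu.emeasure_space_1 by (simp add: \<mu>_def prob_of_def emeasure_density v_inf_eq)
  then have le: "(C / 2) powr p * (2 * sqrt (C / (2 * \<kappa> * real d))) ^ d \<le> 1"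
    using paraboloid_mass_lower[of d p \<kappa> C] d_pos p_pos kappa_pos C_pos by simp
  have "1 < (C / 2) powr p" using big p_pos by simp
  moreover have "1 \<le> (2 * sqrt (C / (2 * \<kappa> * real d))) ^ d"
  proof (rule one_le_power)
    have "1 / 4 \<le> C / (2 * \<kappa> * real d)" using big d_pos kappa_pos by (simp add: field_simps)
    then have "1 / 2 \<le> sqrt (C / (2 * \<kappa> * real d))"
      by (intro real_le_rsqrt) (simp add: power2_eq_square)
    then show "1 \<le> 2 * sqrt (C / (2 * \<kappa> * real d))" by linarith
  qed
  ultimately have "1 * 1 < (C / 2) powr p * (2 * sqrt (C / (2 * \<kappa> * real d))) ^ d"
    by (rule mult_less_le_imp_less) auto
  then show False using le by simp
qed

text \<open>The stationary law lives on a ball of radius \<open>sqrt (C / \<kappa>)\<close>, so all its moments are finite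
  and, with the bound on C, the second moment grows at most linearly in d.\<close>
lemma AE_support: "AE z in \<mu>. \<kappa> * (enorm d z)\<^sup>2 \<le> C"
  unfolding \<mu>_def prob_of_def
  by (subst AE_density) (auto simp: v_inf_eq paraboloid_def max_def not_le)

lemma integrable_enorm_sq: "integrable \<mu> (\<lambda>z. (enorm d z)\<^sup>2)"
  using AE_support kappa_pos
  by (intro mu.integrable_const_bound[of _ "C / \<kappa>"]) (auto simp: field_simps)

lemma second_moment_bounds: "0 \<le> second_moment" "second_moment \<le> C / \<kappa>"
proof -
  show "0 \<le> second_moment" by (simp add: second_moment_def)
  have "second_moment \<le> (\<integral>z. C / \<kappa> \<partial>\<mu>)"
    unfolding second_moment_def using AE_support kappa_pos
    by (intro integral_mono_AE integrable_enorm_sq) (auto simp: field_simps)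
  then show "second_moment \<le> C / \<kappa>" by (simp add: mu.prob_space)
qed

lemma v_inf_powr_le: "v_inf m d z powr (m - 1) \<le> C"
  using m_gt_1 C_pos kappa_pos by (simp add: v_inf_eq paraboloid_def powr_powr p_def)

lemma integrable_inner_energy: "integrable \<mu> (\<lambda>z. v_inf m d z powr (m - 1))"
  using v_inf_powr_le by (intro mu.integrable_const_bound[of _ C]) auto

lemma inner_energy_bounds: "0 \<le> inner_energy" "inner_energy \<le> C"
proof -
  show "0 \<le> inner_energy" by (simp add: inner_energy_def)
  have "inner_energy \<le> (\<integral>z. C \<partial>\<mu>)"
    unfolding inner_energy_def
    by (intro integral_mono integrable_inner_energy v_inf_powr_le) auto
  then show "inner_energy \<le> C" by simp
qed

lemma integrable_component:
  assumes "i < d" shows "integrable \<mu> (\<lambda>z. z i)"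
proof (rule Bochner_Integration.integrable_bound)
  show "integrable \<mu> (\<lambda>z. 1 + (enorm d z)\<^sup>2)" using integrable_enorm_sq by simp
  show "(\<lambda>z. z i) \<in> borel_measurable \<mu>" using assms by measurable
  have "\<bar>z i\<bar> \<le> 1 + (enorm d z)\<^sup>2" for z
  proof -
    have "(z i)\<^sup>2 \<le> (enorm d z)\<^sup>2"
      unfolding enorm_sq using assms by (intro member_le_sum) auto
    moreover have "\<bar>z i\<bar> \<le> 1 + (z i)\<^sup>2" 
    proof -
      have "0 \<le> (\<bar>z i\<bar> - 1 / 2)\<^sup>2" by simp
      then show ?thesis by (simp add: power2_eq_square algebra_simps)
    qed
    ultimately show ?thesis by simp
  qed
  then show "AE z in \<mu>. norm (z i) \<le> norm (1 + (enorm d z)\<^sup>2)" by simp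
qed

text \<open>The stationary density is invariant under \<open>z \<mapsto> - z\<close>.\<close>
lemma mean_zero:
  assumes "i < d" shows "(\<integral>z. z i \<partial>\<mu>) = 0"
proof -
  have *: "v_inf m d (affine_map d (\<lambda>_. 0) (-1) x) = v_inf m d x" for x
    by (simp add: v_inf_eq paraboloid_def enorm_sq_affine) (simp add: enorm_sq)
  have "\<mu> = distr \<mu> (lebR d) (affine_map d (\<lambda>_. 0) (-1))"
  proof (rule measure_eqI)
    fix A assume "A \<in> sets \<mu>"
    then have [measurable]: "A \<in> sets (lebR d)" by simp
    have "emeasure \<mu> A = (\<integral>\<^sup>+ x. ennreal (v_inf m d x) * indicator A x \<partial>lebR d)"
      by (simp add: \<mu>_def prob_of_def emeasure_density)
    also have "\<dots> = (\<integral>\<^sup>+ x. ennreal (v_inf m d x) * indicator A (affine_map d (\<lambda>_. 0) (-1) x) \<partial>lebR d)"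
      by (subst nn_integral_lebR_affine[of "-1" _ _ "\<lambda>_. 0"]) (auto simp: *)
    also have "\<dots> = (\<integral>\<^sup>+ x. ennreal (v_inf m d x)
         * indicator (affine_map d (\<lambda>_. 0) (-1) -` A \<inter> space (lebR d)) x \<partial>lebR d)"
      by (intro nn_integral_cong) (auto simp: indicator_def)
    also have "\<dots> = emeasure (distr \<mu> (lebR d) (affine_map d (\<lambda>_. 0) (-1))) A"
      by (simp add: emeasure_distr) (simp add: \<mu>_def prob_of_def emeasure_density)
    finally show "emeasure \<mu> A = emeasure (distr \<mu> (lebR d) (affine_map d (\<lambda>_. 0) (-1))) A" .
  qed simp
  then have "(\<integral>z. z i \<partial>\<mu>) = (\<integral>z. z i \<partial>distr \<mu> (lebR d) (affine_map d (\<lambda>_. 0) (-1)))"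
    by simp
  also have "\<dots> = (\<integral>z. affine_map d (\<lambda>_. 0) (-1) z i \<partial>\<mu>)"
    using assms by (intro integral_distr) auto
  also have "\<dots> = - (\<integral>z. z i \<partial>\<mu>)" using assms by (simp add: affine_map_def)
  finally show ?thesis by simp
qed

text \<open>
  All three distances reduce to this second moment \<open>E |y + b Z|\<^sup>2\<close>, with different b; the
  cross term vanishes because Z is centred.
\<close>
lemma
  shows integrable_affine_sq: "integrable \<mu> (\<lambda>z. (enorm d (affine_map d y b z))\<^sup>2)"
    and integral_affine_sq:
      "(\<integral>z. (enorm d (affine_map d y b z))\<^sup>2 \<partial>\<mu>) = (enorm d y)\<^sup>2 + b\<^sup>2 * second_moment"
proof -
  have i: "integrable \<mu> (\<lambda>z. \<Sum>i<d. y i * z i)"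
    by (intro Bochner_Integration.integrable_sum integrable_mult_right integrable_component) auto
  have 0: "(\<integral>z. (\<Sum>i<d. y i * z i) \<partial>\<mu>) = 0"
    by (subst Bochner_Integration.integral_sum)
      (auto intro!: integrable_mult_right integrable_component simp: mean_zero)
  show "integrable \<mu> (\<lambda>z. (enorm d (affine_map d y b z))\<^sup>2)"
    unfolding enorm_sq_affine using i integrable_enorm_sq by simp
  show "(\<integral>z. (enorm d (affine_map d y b z))\<^sup>2 \<partial>\<mu>) = (enorm d y)\<^sup>2 + b\<^sup>2 * second_moment"
    unfolding enorm_sq_affine using i integrable_enorm_sq 0
    by (simp add: second_moment_def mu.prob_space)
qed

lemma nn_integral_affine_sq:
  "(\<integral>\<^sup>+ z. ennreal ((enorm d (affine_map d y b z))\<^sup>2) \<partial>\<mu>)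
     = ennreal ((enorm d y)\<^sup>2 + b\<^sup>2 * second_moment)"
  using integrable_affine_sq[of y b] integral_affine_sq[of y b]
  by (subst nn_integral_eq_integral) auto

section \<open>The solution as a moved copy of the stationary law\<close>

text \<open>The self-similar solution is the law of \<open>exp (- t) x0 + l Z\<close>, where the dilation factor l
  differs from 1 only through \<open>exp (- t / a)\<close>.\<close>
lemma sol_eq_moved:
  assumes "t > 0"
  shows "sol m d x0 t = moved (\<lambda>i. exp (- t) * x0 i) ((1 - exp (- t / a)) powr a)"
proof
  fix x
  let ?q = "1 - exp (- t / a)"
  have q: "?q > 0" using assms a_pos by simp
  have "(w powr a) ^ d = w powr (a * real d)" if "w > 0" for w
    using that by (simp add: powr_realpow[symmetric] powr_powr)
  with q have "(a * ?q) powr (a * real d) = a powr (a * real d) * (?q powr a) ^ d"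
    using a_pos by (simp add: powr_mult)
  moreover have "(a * ?q) powr a = a powr a * ?q powr a"
    using q a_pos by (simp add: powr_mult)
  moreover have "(\<lambda>i\<in>{..<d}. w i / (a powr a * ?q powr a))
      = (\<lambda>i\<in>{..<d}. (\<lambda>i\<in>{..<d}. w i / ?q powr a) i / a powr a)" for w :: "nat \<Rightarrow> real"
    by (auto simp: fun_eq_iff)
  ultimately show "sol m d x0 t x = moved (\<lambda>i. exp (- t) * x0 i) (?q powr a) x"
    by (simp add: sol_def moved_def v_inf_def Let_def a_def[symmetric] mult_ac)
qed

context
  fixes y :: "nat \<Rightarrow> real" and l :: real
  assumes l_pos: "l > 0"
begin

lemma measurable_moved [measurable]: "moved y l \<in> borel_measurable (lebR d)"
  and prob_of_moved: "prob_of d (moved y l) = distr \<mu> (lebR d) (affine_map d y l)"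
  using prob_of_affine[of l "v_inf m d" d "moved y l" y] l_pos
  by (auto simp: moved_def[abs_def] \<mu>_def)

lemma moved_nonneg [simp]: "moved y l x \<ge> 0"
  using l_pos by (simp add: moved_def)

lemma moved_affine:
  "z \<in> space (lebR d) \<Longrightarrow> moved y l (affine_map d y l z) = v_inf m d z / l ^ d"
  using affine_map_inverse[of l z d y] l_pos by (simp add: moved_def)

lemma nn_integral_moved:
  assumes [measurable]: "g \<in> borel_measurable (lebR d)"
  shows "(\<integral>\<^sup>+ x. ennreal (moved y l x) * g x \<partial>lebR d) = (\<integral>\<^sup>+ z. g (affine_map d y l z) \<partial>\<mu>)"
proof -
  have "(\<integral>\<^sup>+ x. ennreal (moved y l x) * g x \<partial>lebR d) = (\<integral>\<^sup>+ x. g x \<partial>prob_of d (moved y l))"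
    unfolding prob_of_def by (simp add: nn_integral_density)
  then show ?thesis by (simp add: prob_of_moved nn_integral_distr)
qed

lemma
  fixes g :: "(nat \<Rightarrow> real) \<Rightarrow> real"
  assumes [measurable]: "g \<in> borel_measurable (lebR d)"
  shows integrable_moved: "integrable (lebR d) (\<lambda>x. moved y l x * g x)
            \<longleftrightarrow> integrable \<mu> (\<lambda>z. g (affine_map d y l z))"
    and integral_moved: "(\<integral>x. moved y l x * g x \<partial>lebR d) = (\<integral>z. g (affine_map d y l z) \<partial>\<mu>)"
proof -
  show "integrable (lebR d) (\<lambda>x. moved y l x * g x)
            \<longleftrightarrow> integrable \<mu> (\<lambda>z. g (affine_map d y l z))"
    using integrable_density[of g "lebR d" "moved y l"] prob_of_moved
    by (simp add: prob_of_def integrable_distr_eq)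
  show "(\<integral>x. moved y l x * g x \<partial>lebR d) = (\<integral>z. g (affine_map d y l z) \<partial>\<mu>)"
    using integral_density[of g "lebR d" "moved y l"] prob_of_moved
    by (simp add: prob_of_def integral_distr)
qed

section \<open>The three distances of a moved copy\<close>

lemma powr_divide_power:
  assumes "u \<ge> 0"
  shows "(u / l ^ d) powr (m - 1) = l powr - (real d * (m - 1)) * u powr (m - 1)"
proof -
  have "(l ^ d) powr (m - 1) = l powr (real d * (m - 1))"
    using l_pos by (simp add: powr_realpow[symmetric] powr_powr)
  then show ?thesis using assms l_pos by (simp add: powr_divide powr_minus_divide)
qed

text \<open>The synchronous coupling of \<open>y + l Z\<close> with Z itself has cost \<open>E |y + (l - 1) Z|\<^sup>2\<close>.\<close>
lemma W2_sq_moved_le: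
  "W2_sq m d (moved y l) \<le> ereal ((enorm d y)\<^sup>2 + (l - 1)\<^sup>2 * second_moment)"
proof -
  define T where "T = affine_map d y l"
  have [measurable]: "T \<in> measurable \<mu> (lebR d)" by (simp add: T_def)
  define \<nu> where "\<nu> = prob_of d (moved y l)"
  have nu: "\<nu> = distr \<mu> (lebR d) T" and [measurable_cong, simp]: "sets \<nu> = sets (lebR d)"
    using prob_of_moved by (auto simp: \<nu>_def T_def)
  define \<pi> where "\<pi> = distr \<mu> (\<nu> \<Otimes>\<^sub>M \<mu>) (\<lambda>z. (T z, z))"
  have graph[measurable]: "(\<lambda>z. (T z, z)) \<in> measurable \<mu> (\<nu> \<Otimes>\<^sub>M \<mu>)"
    by measurable
  have "distr \<pi> \<nu> fst = distr \<mu> \<nu> T"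
    unfolding \<pi>_def using graph by (subst distr_distr) (simp_all add: comp_def)
  also have "\<dots> = distr \<mu> (lebR d) T" by (rule distr_cong) simp_all
  finally have "distr \<pi> \<nu> fst = \<nu>" using nu by simp
  moreover have "distr \<pi> \<mu> snd = \<mu>"
    unfolding \<pi>_def using graph by (subst distr_distr) (simp_all add: comp_def distr_id2)
  moreover have "prob_space \<pi>"
    unfolding \<pi>_def using graph by (rule mu.prob_space_distr)
  ultimately have coupling: "\<pi> \<in> couplings \<nu> \<mu>"
    by (auto simp: couplings_def \<pi>_def)
  define cost :: "(nat \<Rightarrow> real) \<times> (nat \<Rightarrow> real) \<Rightarrow> real"
    where "cost z = (enorm d (\<lambda>i\<in>{..<d}. fst z i - snd z i))\<^sup>2" for z
  have cost_eq: "cost = (\<lambda>z. \<Sum>i<d. (fst z i - snd z i)\<^sup>2)"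
    by (simp add: fun_eq_iff cost_def enorm_sq)
  have [measurable]: "cost \<in> borel_measurable (\<nu> \<Otimes>\<^sub>M \<mu>)"
    unfolding cost_eq by measurable
  have "cost (T z, z) = (enorm d (affine_map d y (l - 1) z))\<^sup>2" for z
    unfolding cost_eq enorm_sq T_def affine_map_def
    by (intro sum.cong) (auto simp: algebra_simps)
  then have "(\<integral>\<^sup>+ z. ennreal (cost z) \<partial>\<pi>) = ennreal ((enorm d y)\<^sup>2 + (l - 1)\<^sup>2 * second_moment)"
    unfolding \<pi>_def by (subst nn_integral_distr) (auto simp: nn_integral_affine_sq)
  then have "(INF \<pi> \<in> couplings \<nu> \<mu>. \<integral>\<^sup>+ z. ennreal (cost z) \<partial>\<pi>)
      \<le> ennreal ((enorm d y)\<^sup>2 + (l - 1)\<^sup>2 * second_moment)"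
    using INF_lower[OF coupling, of "\<lambda>\<pi>. \<integral>\<^sup>+ z. ennreal (cost z) \<partial>\<pi>"] by simp
  then have "enn2ereal (INF \<pi> \<in> couplings \<nu> \<mu>. \<integral>\<^sup>+ z. ennreal (cost z) \<partial>\<pi>)
      \<le> ereal ((enorm d y)\<^sup>2 + (l - 1)\<^sup>2 * second_moment)"
    using second_moment_bounds(1) by (intro enn2ereal_le_ereal) auto
  then show ?thesis
    unfolding W2_sq_def W2_def ennsqrt_power2 \<nu>_def \<mu>_def cost_def .
qed

text \<open>The squared transport cost is at least the squared distance between the barycentres: under any
  coupling \<open>|x - z|\<^sup>2 \<ge> 2 y \<bullet> (x - z) - |y|\<^sup>2\<close> pointwise, and the expectation of
  the right-hand side depends on the marginals only.\<close>
lemma W2_sq_moved_ge: "ereal ((enorm d y)\<^sup>2) \<le> W2_sq m d (moved y l)"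
proof -
  define \<nu> where "\<nu> = prob_of d (moved y l)"
  have nu: "\<nu> = distr \<mu> (lebR d) (affine_map d y l)"
    and [measurable_cong, simp]: "sets \<nu> = sets (lebR d)"
    using prob_of_moved by (auto simp: \<nu>_def)
  have "ennreal ((enorm d y)\<^sup>2)
      \<le> (\<integral>\<^sup>+ z. ennreal ((enorm d (\<lambda>i\<in>{..<d}. fst z i - snd z i))\<^sup>2) \<partial>\<pi>)"
    if "\<pi> \<in> couplings \<nu> \<mu>" for \<pi>
  proof -
    from that have "prob_space \<pi>" and [measurable_cong]: "sets \<pi> = sets (\<nu> \<Otimes>\<^sub>M \<mu>)"
      and fst: "distr \<pi> \<nu> fst = \<nu>" and snd: "distr \<pi> \<mu> snd = \<mu>"
      by (auto simp: couplings_def)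
    interpret pi: prob_space \<pi> by fact
    have [measurable]: "fst \<in> measurable \<pi> \<nu>" "snd \<in> measurable \<pi> \<mu>"
      by (measurable; simp)+
    define L where "L z = 2 * (\<Sum>i<d. y i * (fst z i - snd z i)) - (enorm d y)\<^sup>2"
      for z :: "(nat \<Rightarrow> real) \<times> (nat \<Rightarrow> real)"
    have int_nu: "integrable \<nu> (\<lambda>x. x i)" "(\<integral>x. x i \<partial>\<nu>) = y i" if "i < d" for i
      using that integrable_component[OF that] mean_zero[OF that] unfolding nu
      by (auto simp: integrable_distr_eq integral_distr affine_map_def mu.prob_space)
    have fst_i: "integrable \<pi> (\<lambda>z. fst z i)" "(\<integral>z. fst z i \<partial>\<pi>) = y i" if "i < d" for i
    proof -
      have "integrable (distr \<pi> \<nu> fst) (\<lambda>x. x i)" "(\<integral>x. x i \<partial>distr \<pi> \<nu> fst) = y i"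
        unfolding fst using int_nu[OF that] by auto
      then show "integrable \<pi> (\<lambda>z. fst z i)" "(\<integral>z. fst z i \<partial>\<pi>) = y i"
        using that by (auto simp: integrable_distr_eq integral_distr)
    qed
    have snd_i: "integrable \<pi> (\<lambda>z. snd z i)" "(\<integral>z. snd z i \<partial>\<pi>) = 0" if "i < d" for i
    proof -
      have "integrable (distr \<pi> \<mu> snd) (\<lambda>x. x i)" "(\<integral>x. x i \<partial>distr \<pi> \<mu> snd) = 0"
        unfolding snd using integrable_component[OF that] mean_zero[OF that] by auto
      then show "integrable \<pi> (\<lambda>z. snd z i)" "(\<integral>z. snd z i \<partial>\<pi>) = 0"
        using that by (auto simp: integrable_distr_eq integral_distr)
    qed
    have s: "integrable \<pi> (\<lambda>z. \<Sum>i<d. y i * (fst z i - snd z i))"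
      using fst_i snd_i by (intro Bochner_Integration.integrable_sum) auto
    have "(\<integral>z. (\<Sum>i<d. y i * (fst z i - snd z i)) \<partial>\<pi>) = (\<Sum>i<d. y i * y i)"
      using fst_i snd_i by (subst Bochner_Integration.integral_sum) auto
    also have "\<dots> = (enorm d y)\<^sup>2" by (subst enorm_sq) (simp add: power2_eq_square)
    finally have L: "integrable \<pi> L" "(\<integral>z. L z \<partial>\<pi>) = (enorm d y)\<^sup>2"
      using s unfolding L_def[abs_def] by (auto simp: pi.prob_space)
    have "L z \<le> (enorm d (\<lambda>i\<in>{..<d}. fst z i - snd z i))\<^sup>2" for z
    proof -
      have "0 \<le> (\<Sum>i<d. (fst z i - snd z i - y i)\<^sup>2)" by (intro sum_nonneg) auto
      also have "\<dots> = (\<Sum>i<d. (fst z i - snd z i)\<^sup>2 - 2 * (y i * (fst z i - snd z i)) + (y i)\<^sup>2)"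
        by (intro sum.cong) (auto simp: power2_eq_square algebra_simps)
      finally show ?thesis
        by (simp add: L_def enorm_sq sum.distrib sum_subtractf sum_distrib_left)
    qed
    then have "(\<integral>\<^sup>+ z. ennreal (L z) \<partial>\<pi>)
        \<le> (\<integral>\<^sup>+ z. ennreal ((enorm d (\<lambda>i\<in>{..<d}. fst z i - snd z i))\<^sup>2) \<partial>\<pi>)"
      by (intro nn_integral_mono ennreal_leI)
    moreover have "ennreal (\<integral>z. L z \<partial>\<pi>) \<le> (\<integral>\<^sup>+ z. ennreal (L z) \<partial>\<pi>)"
    proof -
      have "(\<integral>z. L z \<partial>\<pi>) \<le> enn2real (\<integral>\<^sup>+ z. ennreal (L z) \<partial>\<pi>)"
        using real_lebesgue_integral_def[OF L(1)] by simp
      then have "ennreal (\<integral>z. L z \<partial>\<pi>) \<le> ennreal (enn2real (\<integral>\<^sup>+ z. ennreal (L z) \<partial>\<pi>))"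
        by (rule ennreal_leI)
      then show ?thesis
        using L(1) by (simp add: real_integrable_def ennreal_enn2real_if)
    qed
    ultimately show ?thesis using L(2) by simp
  qed
  then have "ennreal ((enorm d y)\<^sup>2) \<le> (INF \<pi> \<in> couplings \<nu> \<mu>.
      \<integral>\<^sup>+ z. ennreal ((enorm d (\<lambda>i\<in>{..<d}. fst z i - snd z i))\<^sup>2) \<partial>\<pi>)"
    by (rule INF_greatest)
  then have "ereal ((enorm d y)\<^sup>2) \<le> enn2ereal (INF \<pi> \<in> couplings \<nu> \<mu>.
      \<integral>\<^sup>+ z. ennreal ((enorm d (\<lambda>i\<in>{..<d}. fst z i - snd z i))\<^sup>2) \<partial>\<pi>)"
    by (intro ereal_le_enn2ereal) auto
  then show ?thesis
    unfolding W2_sq_def W2_def ennsqrt_power2 \<nu>_def \<mu>_def .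
qed

text \<open>Writing \<open>f powr m = f * f powr (m - 1)\<close> turns the entropy into a difference of two
  expectations. Under dilation by l the density is divided by \<open>l ^ d\<close>, so the expectation of
  its power m - 1 scales by \<open>l powr (- d (m - 1))\<close>, while the quadratic part is a second moment.\<close>
lemma rel_entropy_moved:
  "rel_entropy m d (moved y l)
     = ereal ((enorm d y)\<^sup>2 / 2 - (1 - l\<^sup>2) / 2 * second_moment
              + (l powr - (real d * (m - 1)) - 1) * inner_energy / (m - 1))"
proof -
  let ?f = "moved y l" and ?v = "v_inf m d" and ?e = "\<lambda>x. (m - 1) / 2 * (enorm d x)\<^sup>2"
  have split: "?f x powr m - ?v x powr m - (1 - m) / 2 * (enorm d x)\<^sup>2 * (?f x - ?v x)
      = ?f x * (?f x powr (m - 1) + ?e x) - ?v x * (?v x powr (m - 1) + ?e x)" for x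
  proof -
    have "u powr m = u * u powr (m - 1)" if "u \<ge> 0" for u :: real
      using powr_mult_base[OF that, of "m - 1"] by simp
    then have "?f x powr m = ?f x * ?f x powr (m - 1)" "?v x powr m = ?v x * ?v x powr (m - 1)"
      using moved_nonneg by auto
    then show ?thesis by (simp add: algebra_simps diff_divide_distrib)
  qed
  have iU: "integrable \<mu> (\<lambda>z. ?v z powr (m - 1))"
    by (rule integrable_inner_energy)
  have f: "integrable (lebR d) (\<lambda>x. ?f x * (?f x powr (m - 1) + ?e x))"
    "(\<integral>x. ?f x * (?f x powr (m - 1) + ?e x) \<partial>lebR d)
      = l powr - (real d * (m - 1)) * inner_energy
        + (m - 1) / 2 * ((enorm d y)\<^sup>2 + l\<^sup>2 * second_moment)"
  proof -
    let ?g = "\<lambda>z. l powr - (real d * (m - 1)) * ?v z powr (m - 1)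
        + (m - 1) / 2 * (enorm d (affine_map d y l z))\<^sup>2"
    have eq: "?f (affine_map d y l z) powr (m - 1) + ?e (affine_map d y l z) = ?g z"
      if "z \<in> space \<mu>" for z
      using that by (simp add: moved_affine powr_divide_power)
      have meas: "(\<lambda>x. ?f x powr (m - 1) + ?e x) \<in> borel_measurable (lebR d)" by measurable
    have "integrable \<mu> ?g" using iU integrable_affine_sq[of y l] by simp
    then have "integrable \<mu> (\<lambda>z. ?f (affine_map d y l z) powr (m - 1) + ?e (affine_map d y l z))"
      by (subst Bochner_Integration.integrable_cong[OF refl eq])
    then show "integrable (lebR d) (\<lambda>x. ?f x * (?f x powr (m - 1) + ?e x))"
      using integrable_moved[OF meas] by blast
    have "(\<integral>x. ?f x * (?f x powr (m - 1) + ?e x) \<partial>lebR d)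
        = (\<integral>z. ?f (affine_map d y l z) powr (m - 1) + ?e (affine_map d y l z) \<partial>\<mu>)"
      by (rule integral_moved[OF meas])
    also have "\<dots> = (\<integral>z. ?g z \<partial>\<mu>)"
      by (rule Bochner_Integration.integral_cong[OF refl eq])
    also have "\<dots> = l powr - (real d * (m - 1)) * inner_energy
        + (m - 1) / 2 * ((enorm d y)\<^sup>2 + l\<^sup>2 * second_moment)"
      using iU integrable_affine_sq[of y l] integral_affine_sq[of y l] by (simp add: inner_energy_def)
    finally show "(\<integral>x. ?f x * (?f x powr (m - 1) + ?e x) \<partial>lebR d) = \<dots>" .
  qed
  have v: "integrable (lebR d) (\<lambda>x. ?v x * (?v x powr (m - 1) + ?e x))"
    "(\<integral>x. ?v x * (?v x powr (m - 1) + ?e x) \<partial>lebR d)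
      = inner_energy + (m - 1) / 2 * second_moment"
  proof -
    have "integrable \<mu> (\<lambda>x. ?v x powr (m - 1) + ?e x)"
      using iU integrable_enorm_sq by simp
    then show "integrable (lebR d) (\<lambda>x. ?v x * (?v x powr (m - 1) + ?e x))"
      unfolding \<mu>_def prob_of_def by (subst (asm) integrable_density) auto
    have "(\<integral>x. ?v x * (?v x powr (m - 1) + ?e x) \<partial>lebR d) = (\<integral>x. ?v x powr (m - 1) + ?e x \<partial>\<mu>)"
      unfolding \<mu>_def prob_of_def by (subst integral_density) auto
    also have "\<dots> = inner_energy + (m - 1) / 2 * second_moment"
      using iU integrable_enorm_sq by (simp add: inner_energy_def second_moment_def)
    finally show "(\<integral>x. ?v x * (?v x powr (m - 1) + ?e x) \<partial>lebR d) = \<dots>" .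
  qed
  show ?thesis
  proof -
    have "integrable (lebR d) (\<lambda>x. ?f x * (?f x powr (m - 1) + ?e x) - ?v x * (?v x powr (m - 1) + ?e x))"
      using f(1) v(1) by (rule Bochner_Integration.integrable_diff)
    then have "rel_entropy m d (moved y l) = ereal (1 / (m - 1) *
        ((l powr - (real d * (m - 1)) * inner_energy
          + (m - 1) / 2 * ((enorm d y)\<^sup>2 + l\<^sup>2 * second_moment))
         - (inner_energy + (m - 1) / 2 * second_moment)))"
      unfolding rel_entropy_def Let_def split
      using Bochner_Integration.integral_diff[OF f(1) v(1)] f(2) v(2) by (simp only: if_True)
    also have "1 / (m - 1) *
        ((P * inner_energy + (m - 1) / 2 * ((enorm d y)\<^sup>2 + l\<^sup>2 * second_moment))
         - (inner_energy + (m - 1) / 2 * second_moment))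
      = (enorm d y)\<^sup>2 / 2 - (1 - l\<^sup>2) / 2 * second_moment + (P - 1) * inner_energy / (m - 1)" for P
    proof -
      define w where "w = m - 1"
      have "w > 0" using m_gt_1 by (simp add: w_def)
      then show ?thesis unfolding w_def[symmetric] by (simp add: field_simps)
    qed
    finally show ?thesis .
  qed
qed

text \<open>The power m - 1 of the density is a truncated quadratic polynomial. Where it is positive the
  truncation is locally inactive, and the constant \<open>\<kappa> = (m - 1) / (2 m)\<close> is exactly what
  makes \<open>m / (m - 1)\<close> times its gradient equal to \<open>- \<theta> (x - y)\<close>, where
  \<open>\<theta> = l powr (- d (m - 1) - 2) = l powr (- 1 / a)\<close>.\<close>
lemma partial_deriv_moved:
  assumes i: "i < d" and x: "moved y l x \<noteq> 0"
  shows "m / (m - 1) * partial_deriv i (\<lambda>w. moved y l w powr (m - 1)) x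
           = - (l powr (- 1 / a)) * (x i - y i)"
proof -
  define K where "K = l powr - (real d * (m - 1))"
  \<comment> \<open>Along the i-th coordinate line the other coordinates only contribute the constant R.\<close>
  define R where "R = (\<Sum>j\<in>{..<d} - {i}. (x j - y j)\<^sup>2)"
  define G where "G s = C - \<kappa> * ((R + (s - y i)\<^sup>2) / l\<^sup>2)" for s
  have moved_eq: "moved y l w powr (m - 1) = K * max 0 (C - \<kappa> * ((\<Sum>j<d. (w j - y j)\<^sup>2) / l\<^sup>2))"
    for w
  proof -
    have "moved y l w powr (m - 1) = K * v_inf m d (\<lambda>j\<in>{..<d}. (w j - y j) / l) powr (m - 1)"
      unfolding K_def moved_def by (rule powr_divide_power) simp
    also have "v_inf m d (\<lambda>j\<in>{..<d}. (w j - y j) / l) powr (m - 1)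
        = max 0 (C - \<kappa> * ((\<Sum>j<d. (w j - y j)\<^sup>2) / l\<^sup>2))"
      using m_gt_1 l_pos by (simp add: v_inf_eq paraboloid_def powr_powr p_def enorm_sq_rescale)
    finally show ?thesis .
  qed
  have "(\<Sum>j<d. ((x(i := s)) j - y j)\<^sup>2) = R + (s - y i)\<^sup>2" for s
    unfolding R_def using i by (subst sum.remove[of _ i]) auto
  then have slice: "moved y l (x(i := s)) powr (m - 1) = K * max 0 (G s)" for s
    unfolding moved_eq G_def by simp
  have "K * max 0 (G (x i)) \<noteq> 0"
    using x slice[of "x i"] by (metis fun_upd_triv powr_eq_0_iff)
  then have pos: "G (x i) > 0" by (auto simp: max_def split: if_splits)
  have cont: "isCont G (x i)" unfolding G_def[abs_def] using l_pos by (intro continuous_intros) auto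
  have der: "((\<lambda>s. K * G s) has_real_derivative K * (- \<kappa> * (2 * (x i - y i) / l\<^sup>2))) (at (x i))"
    unfolding G_def using l_pos
    by (auto intro!: derivative_eq_intros simp: field_simps power2_eq_square)
  have ev: "eventually (\<lambda>s. K * G s = moved y l (x(i := s)) powr (m - 1)) (nhds (x i))"
    using order_tendstoD(1)[OF cont[unfolded isCont_def tendsto_at_iff_tendsto_nhds] pos]
    by eventually_elim (simp add: slice)
  have "((\<lambda>s. moved y l (x(i := s)) powr (m - 1))
      has_real_derivative K * (- \<kappa> * (2 * (x i - y i) / l\<^sup>2))) (at (x i))"
    by (rule DERIV_cong_ev[OF refl ev refl, THEN iffD1, OF der])
  then have "partial_deriv i (\<lambda>w. moved y l w powr (m - 1)) x = K * (- \<kappa> * (2 * (x i - y i) / l\<^sup>2))"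
    unfolding partial_deriv_def by (rule DERIV_imp_deriv)
  moreover have "m / (m - 1) * (K * (- \<kappa> * (2 * (x i - y i) / l\<^sup>2))) = - (K / l\<^sup>2) * (x i - y i)"
    unfolding \<kappa>_def using m_gt_1 l_pos by (simp add: field_simps)
  moreover have "K / l\<^sup>2 = l powr (- 1 / a)"
  proof -
    have "- 1 / a = - (real d * (m - 1)) - 2" using inverse_a by (simp add: minus_divide_left[symmetric])
    then show ?thesis unfolding K_def using l_pos by (simp add: powr_diff)
  qed
  ultimately show ?thesis by simp
qed

text \<open>By the gradient formula the integrand is \<open>|x - \<theta> (x - y)|\<^sup>2\<close> with
  \<open>\<theta> = l powr (- 1 / a)\<close>, which at \<open>x = y + l Z\<close> equals \<open>|y + (1 - \<theta>) l Z|\<^sup>2\<close>.\<close>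
lemma fisher_info_moved:
  "fisher_info m d (moved y l)
     = ereal ((enorm d y)\<^sup>2 + (1 - l powr (- 1 / a))\<^sup>2 * l\<^sup>2 * second_moment)"
proof -
  let ?\<theta> = "l powr (- 1 / a)"
  define g where "g x = (\<Sum>i<d. (x i - ?\<theta> * (x i - y i))\<^sup>2)" for x
  have [measurable]: "g \<in> borel_measurable (lebR d)" unfolding g_def[abs_def] by measurable
  have "ennreal (moved y l x * (enorm d (\<lambda>i\<in>{..<d}. x i + m / (m - 1) *
        (if moved y l x = 0 then 0 else partial_deriv i (\<lambda>y'. moved y l y' powr (m - 1)) x)))\<^sup>2)
      = ennreal (moved y l x) * ennreal (g x)" for x
  proof (cases "moved y l x = 0")
    case False
    have "(enorm d (\<lambda>i\<in>{..<d}. x i + m / (m - 1) * partial_deriv i (\<lambda>y'. moved y l y' powr (m - 1)) x))\<^sup>2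
       = g x"
      unfolding enorm_sq g_def using partial_deriv_moved[OF _ False]
      by (intro sum.cong) auto
    then show ?thesis using False moved_nonneg[of x] by (simp add: ennreal_mult')
  qed simp
  then have "fisher_info m d (moved y l)
      = enn2ereal (\<integral>\<^sup>+ x. ennreal (moved y l x) * ennreal (g x) \<partial>lebR d)"
    unfolding fisher_info_def by simp
  also have "\<dots> = enn2ereal (\<integral>\<^sup>+ z. ennreal (g (affine_map d y l z)) \<partial>\<mu>)"
    by (subst nn_integral_moved) auto
  also have "\<dots> = enn2ereal (\<integral>\<^sup>+ z.
      ennreal ((enorm d (affine_map d y ((1 - ?\<theta>) * l) z))\<^sup>2) \<partial>\<mu>)"
  proof -
    have "g (affine_map d y l z) = (enorm d (affine_map d y ((1 - ?\<theta>) * l) z))\<^sup>2" for z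
      unfolding g_def enorm_sq affine_map_def by (intro sum.cong) (auto simp: algebra_simps)
    then show ?thesis by simp
  qed
  also have "\<dots> = enn2ereal (ennreal ((enorm d y)\<^sup>2 + ((1 - ?\<theta>) * l)\<^sup>2 * second_moment))"
    by (simp only: nn_integral_affine_sq)
  also have "\<dots> = ereal ((enorm d y)\<^sup>2 + ((1 - ?\<theta>) * l)\<^sup>2 * second_moment)"
    using second_moment_bounds(1) by (intro enn2ereal_ennreal) simp
  finally show ?thesis by (simp only: power_mult_distrib)
qed

end

section \<open>Distances along the flow\<close>

text \<open>One error for all three distances: q times a bound for twice the sum of \<^term>\<open>second_moment\<close> and
  \<^term>\<open>inner_energy / (m - 1)\<close>, in which C has been replaced by \<open>2 + \<kappa> d\<close>.\<close>
definition error where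
  "error q = 2 * q * ((2 + \<kappa> * real d) * (1 / \<kappa> + 1 / (m - 1)))"

text \<open>At the dilation factor of the flow, all corrections to the leading term \<open>K |y|\<^sup>2\<close> are of
  order q times the second moment of Z or the expectation of \<open>v powr (m - 1)\<close>, both of which
  are at most linear in d.\<close>
lemma dist_moved_bounds:
  assumes q: "0 < q" "q \<le> 1 / 2" and l: "l = (1 - q) powr a"
    and dist: "dist_to_inf \<in> {W2_sq m, rel_entropy m, fisher_info m}"
    and K: "K = (if dist_to_inf = rel_entropy m then 1 / 2 else 1)"
  shows "ereal (K * (enorm d y)\<^sup>2 - error q) \<le> dist_to_inf d (moved y l)"
    and "dist_to_inf d (moved y l) \<le> ereal (K * (enorm d y)\<^sup>2 + error q)"
proof -
  have l0: "l > 0" and l1: "l \<le> 1" using q a_pos by (auto simp: l powr_le1)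
  \<comment> \<open>Since \<open>2 a \<le> 1\<close>, the dilation factor satisfies \<open>1 - q \<le> l\<^sup>2 \<le> 1\<close>.\<close>
  have "(1 - q) powr 1 \<le> (1 - q) powr (2 * a)"
    using q a_le_half by (intro powr_mono') auto
  also have "\<dots> = l\<^sup>2" by (simp add: l power2_eq_square powr_add[symmetric])
  finally have lq: "1 - l\<^sup>2 \<le> q" using q by simp
  have l2: "l\<^sup>2 \<le> l" "l\<^sup>2 \<le> 1" using l0 l1 by (auto simp: power2_eq_square mult_le_one)
  have inv: "1 / (1 - q) \<le> 1 + 2 * q" "1 \<le> 1 / (1 - q)"
    using q mult_left_mono[of q "1 / 2" q] by (auto simp: field_simps)
  have Z: "0 \<le> q * second_moment" "0 \<le> q * inner_energy / (m - 1)"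
    using q second_moment_bounds inner_energy_bounds m_gt_1 by auto
  have err: "2 * q * second_moment + 2 * (q * inner_energy / (m - 1)) \<le> error q"
  proof -
    have "second_moment \<le> (2 + \<kappa> * real d) / \<kappa>"
      using second_moment_bounds(2) C_le kappa_pos by (meson divide_right_mono less_imp_le order_trans)
    moreover have "inner_energy / (m - 1) \<le> (2 + \<kappa> * real d) / (m - 1)"
      using inner_energy_bounds(2) C_le m_gt_1 by (intro divide_right_mono) auto
    ultimately have "second_moment + inner_energy / (m - 1)
        \<le> (2 + \<kappa> * real d) * (1 / \<kappa> + 1 / (m - 1))"
      by (simp add: distrib_left)
    then have "2 * q * (second_moment + inner_energy / (m - 1)) \<le> error q"
      unfolding error_def using q by (intro mult_left_mono) auto
    then show ?thesis by (simp add: distrib_left)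
  qed
  consider "dist_to_inf = rel_entropy m"
    | "dist_to_inf \<noteq> rel_entropy m" "dist_to_inf = W2_sq m"
    | "dist_to_inf \<noteq> rel_entropy m" "dist_to_inf = fisher_info m"
    using dist by auto
  then have "ereal (K * (enorm d y)\<^sup>2 - error q) \<le> dist_to_inf d (moved y l)
      \<and> dist_to_inf d (moved y l) \<le> ereal (K * (enorm d y)\<^sup>2 + error q)"
  proof cases
    case 1
    then have Keq: "K = 1 / 2" using K by simp
    \<comment> \<open>The exponent of \<open>1 - q\<close> in P lies in \<open>[-1, 0]\<close>.\<close>
    define P where "P = l powr - (real d * (m - 1))"
    have "P = (1 - q) powr (2 * a - 1)"
      unfolding P_def l powr_powr using a_dm by (simp add: mult.assoc)
    moreover have "(1 - q) powr (2 * a - 1) \<le> (1 - q) powr (- 1)"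
      using q a_pos by (intro powr_mono') auto
    moreover have "(1 - q) powr 0 \<le> (1 - q) powr (2 * a - 1)"
      using q a_le_half by (intro powr_mono') auto
    ultimately have P: "0 \<le> P - 1" "P - 1 \<le> 2 * q"
      using q inv by (auto simp: powr_minus_divide)
    have "(1 - l\<^sup>2) / 2 * second_moment \<le> q * second_moment"
      using lq q second_moment_bounds(1) by (intro mult_right_mono) auto
    moreover have "0 \<le> (1 - l\<^sup>2) / 2 * second_moment"
      using l2 second_moment_bounds(1) by simp
    moreover have "(P - 1) * inner_energy / (m - 1) \<le> 2 * (q * inner_energy / (m - 1))"
    proof -
      have "(P - 1) * (inner_energy / (m - 1)) \<le> 2 * q * (inner_energy / (m - 1))"
        using P inner_energy_bounds(1) m_gt_1 by (intro mult_right_mono) auto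
      then show ?thesis by simp
    qed
    moreover have "0 \<le> (P - 1) * inner_energy / (m - 1)"
      using P inner_energy_bounds(1) m_gt_1 by simp
    ultimately have "1 / 2 * (enorm d y)\<^sup>2 - error q
        \<le> (enorm d y)\<^sup>2 / 2 - (1 - l\<^sup>2) / 2 * second_moment + (P - 1) * inner_energy / (m - 1)"
      "(enorm d y)\<^sup>2 / 2 - (1 - l\<^sup>2) / 2 * second_moment + (P - 1) * inner_energy / (m - 1)
        \<le> 1 / 2 * (enorm d y)\<^sup>2 + error q"
      using err Z by linarith+
    then show ?thesis
      unfolding 1 Keq rel_entropy_moved[OF l0] P_def[symmetric] by simp
  next
    case 2
    have "(l - 1)\<^sup>2 \<le> 1 - l"
      using l0 l1 mult_right_mono[of "1 - l" 1 "1 - l"] by (simp add: power2_eq_square algebra_simps)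
    also have "\<dots> \<le> q" using l2 lq by linarith
    finally have "(l - 1)\<^sup>2 * second_moment \<le> q * second_moment"
      using second_moment_bounds(1) by (intro mult_right_mono)
    then have "ereal ((enorm d y)\<^sup>2 + (l - 1)\<^sup>2 * second_moment) \<le> ereal ((enorm d y)\<^sup>2 + error q)"
      and "ereal ((enorm d y)\<^sup>2 - error q) \<le> ereal ((enorm d y)\<^sup>2)"
      using err Z by auto
    then show ?thesis
      using 2 K by (auto intro: order_trans[OF W2_sq_moved_le[OF l0]]
          order_trans[OF _ W2_sq_moved_ge[OF l0]])
  next
    case 3
    have "l powr (- 1 / a) = 1 / (1 - q)"
      unfolding l powr_powr using a_pos q by (simp add: powr_minus_divide)
    then have "0 \<le> l powr (- 1 / a) - 1" "l powr (- 1 / a) - 1 \<le> 2 * q" using inv by auto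
    then have "(l powr (- 1 / a) - 1) * (l powr (- 1 / a) - 1) \<le> (2 * q) * 1"
      using q by (intro mult_mono) auto
    then have "(1 - l powr (- 1 / a))\<^sup>2 * l\<^sup>2 \<le> (2 * q) * 1"
      using l2 q by (intro mult_mono) (auto simp: power2_eq_square algebra_simps)
    then have "(1 - l powr (- 1 / a))\<^sup>2 * l\<^sup>2 * second_moment \<le> 2 * q * 1 * second_moment"
      using second_moment_bounds(1) by (intro mult_right_mono)
    moreover have "0 \<le> (1 - l powr (- 1 / a))\<^sup>2 * l\<^sup>2 * second_moment"
      using second_moment_bounds(1) by simp
    ultimately show ?thesis
      using 3 K err Z by (simp add: fisher_info_moved[OF l0])
  qed
  then show "ereal (K * (enorm d y)\<^sup>2 - error q) \<le> dist_to_inf d (moved y l)"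
    and "dist_to_inf d (moved y l) \<le> ereal (K * (enorm d y)\<^sup>2 + error q)" by auto
qed

lemma SUP_dist_sol_bounds:
  assumes t: "t > 0" and q: "exp (- t / a) \<le> 1 / 2" and r: "r > 0"
    and dist: "dist_to_inf \<in> {W2_sq m, rel_entropy m, fisher_info m}"
    and K: "K = (if dist_to_inf = rel_entropy m then 1 / 2 else 1)"
    and S: "S = (SUP x0 \<in> {x0 \<in> {..<d} \<rightarrow>\<^sub>E UNIV. enorm d x0 \<le> r * sqrt (real d)}. dist_to_inf d (sol m d x0 t))"
  shows "ereal (K * (exp (- 2 * t) * (r\<^sup>2 * real d)) - error (exp (- t / a))) \<le> S"
    and "S \<le> ereal (K * (exp (- 2 * t) * (r\<^sup>2 * real d)) + error (exp (- t / a)))"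
proof -
  have y: "(enorm d (\<lambda>i. exp (- t) * x0 i))\<^sup>2 = exp (- 2 * t) * (enorm d x0)\<^sup>2" for x0
    by (simp add: enorm_sq power_mult_distrib sum_distrib_left exp_double[symmetric] flip: exp_double)
  have bounds: "ereal (K * (exp (- 2 * t) * (enorm d x0)\<^sup>2) - error (exp (- t / a))) \<le> dist_to_inf d (sol m d x0 t)"
    "dist_to_inf d (sol m d x0 t) \<le> ereal (K * (exp (- 2 * t) * (enorm d x0)\<^sup>2) + error (exp (- t / a)))"
    for x0
    using dist_moved_bounds[OF exp_gt_zero q refl dist K, of "\<lambda>i. exp (- t) * x0 i"]
    unfolding y sol_eq_moved[OF t] by auto
  have K0: "K \<ge> 0" using K by simp
  show "S \<le> ereal (K * (exp (- 2 * t) * (r\<^sup>2 * real d)) + error (exp (- t / a)))"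
    unfolding S
  proof (rule SUP_least)
    fix x0 assume "x0 \<in> {x0 \<in> {..<d} \<rightarrow>\<^sub>E UNIV. enorm d x0 \<le> r * sqrt (real d)}"
    then have "(enorm d x0)\<^sup>2 \<le> (r * sqrt (real d))\<^sup>2"
      by (intro power_mono) (auto simp: enorm_def)
    then have "(enorm d x0)\<^sup>2 \<le> r\<^sup>2 * real d" by (simp add: power_mult_distrib)
    then have "K * (exp (- 2 * t) * (enorm d x0)\<^sup>2) \<le> K * (exp (- 2 * t) * (r\<^sup>2 * real d))"
      using K0 by (intro mult_left_mono) auto
    then have "ereal (K * (exp (- 2 * t) * (enorm d x0)\<^sup>2) + error (exp (- t / a)))
        \<le> ereal (K * (exp (- 2 * t) * (r\<^sup>2 * real d)) + error (exp (- t / a)))" by simp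
    then show "dist_to_inf d (sol m d x0 t) \<le> ereal (K * (exp (- 2 * t) * (r\<^sup>2 * real d)) + error (exp (- t / a)))"
      using bounds(2)[of x0] by (rule order_trans[rotated])
  qed
  \<comment> \<open>A vector of norm exactly \<open>r sqrt d\<close> attains the leading term.\<close>
  let ?x = "\<lambda>i\<in>{..<d}. r"
  have x: "(enorm d ?x)\<^sup>2 = r\<^sup>2 * real d" by (simp add: enorm_sq mult.commute)
  have "enorm d ?x = sqrt ((enorm d ?x)\<^sup>2)" by (simp add: enorm_def)
  also have "\<dots> = r * sqrt (real d)" unfolding x using r by (simp add: real_sqrt_mult)
  finally have "?x \<in> {x0 \<in> {..<d} \<rightarrow>\<^sub>E UNIV. enorm d x0 \<le> r * sqrt (real d)}" by simp
  then have "dist_to_inf d (sol m d ?x t) \<le> S" unfolding S by (rule SUP_upper)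
  then show "ereal (K * (exp (- 2 * t) * (r\<^sup>2 * real d)) - error (exp (- t / a))) \<le> S"
    using bounds(1)[of ?x] unfolding x by (rule order_trans[rotated])
qed

end

section \<open>The limit of high dimension\<close>

text \<open>Since \<open>1 / a = 2 + d (m - 1)\<close>, at times of order \<open>ln d\<close> the quantity
  \<open>exp (- t / a)\<close> decays like \<open>d powr (- const * d)\<close> and beats the linear growth of the moments.\<close>
lemma error_tendsto_0:
  assumes "m > 1" "\<beta> > 0"
  defines "t \<equiv> \<lambda>d::nat. \<beta> * ln (real d)"
  shows "(\<lambda>d. exp (- t d / porous_medium.a m d)) \<longlonglongrightarrow> 0"
    and "(\<lambda>d. porous_medium.error m d (exp (- t d / porous_medium.a m d))) \<longlonglongrightarrow> 0"
proof -
  define w where "w = m - 1"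
  have w: "w > 0" using assms by (simp add: w_def)
  have rate: "- t d / porous_medium.a m d = - (\<beta> * ln (real d)) * (2 + real d * w)" if "d \<ge> 1" for d
  proof -
    interpret porous_medium m d using assms that by unfold_locales auto
    have "- t d / a = - t d * (1 / a)" by simp
    then show ?thesis unfolding inverse_a by (simp add: t_def w_def)
  qed
  have ev: "eventually (\<lambda>d. exp (- t d / porous_medium.a m d)
      = exp (- (\<beta> * ln (real d)) * (2 + real d * w))) sequentially"
    using eventually_ge_at_top[of 1] by eventually_elim (simp only: rate)
  have "(\<lambda>d::nat. exp (- (\<beta> * ln (real d)) * (2 + real d * w))) \<longlonglongrightarrow> 0"
    using w assms(2) by real_asymp
  then show "(\<lambda>d. exp (- t d / porous_medium.a m d)) \<longlonglongrightarrow> 0"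
    by (rule Lim_transform_eventually) (use ev in \<open>eventually_elim, simp\<close>)
  define k where "k = (m - 1) / (2 * m)"
  have k_pos: "k > 0" using assms by (simp add: k_def)
  define c where "c = 1 / k + 1 / (m - 1)"
  have "(\<lambda>d::nat. exp (- (\<beta> * ln (real d)) * (2 + real d * w)) * (2 + k * real d)) \<longlonglongrightarrow> 0"
    using w k_pos assms(2) by real_asymp
  then have "(\<lambda>d::nat. 2 * (exp (- (\<beta> * ln (real d)) * (2 + real d * w)) * (2 + k * real d)) * c) \<longlonglongrightarrow> 2 * 0 * c"
    by (intro tendsto_intros)
  then have "(\<lambda>d::nat. 2 * (exp (- (\<beta> * ln (real d)) * (2 + real d * w)) * (2 + k * real d)) * c) \<longlonglongrightarrow> 0"
    by simp
  moreover have "eventually (\<lambda>d. 2 * (exp (- (\<beta> * ln (real d)) * (2 + real d * w)) * (2 + k * real d)) * c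
      = porous_medium.error m d (exp (- t d / porous_medium.a m d))) sequentially"
    using ev eventually_ge_at_top[of 1]
  proof eventually_elim
    case (elim d)
    interpret porous_medium m d using assms elim by unfold_locales auto
    show ?case unfolding elim(1) error_def c_def k_def \<kappa>_def by simp
  qed
  ultimately show "(\<lambda>d. porous_medium.error m d (exp (- t d / porous_medium.a m d))) \<longlonglongrightarrow> 0"
    by (rule Lim_transform_eventually)
qed

text \<open>The leading term is \<open>exp (- 2 t) r\<^sup>2 d\<close>; at \<open>t = \<beta> ln d\<close> this is
  \<open>r\<^sup>2\<close> times \<open>d powr (1 - 2 \<beta>)\<close>, which changes behaviour at \<open>\<beta> = 1 / 2\<close>.\<close>
lemma eventually_SUP_dist_sol_bounds:
  fixes m r \<beta> :: real
  assumes "m > 1" "r > 0" "\<beta> > 0"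
    and "dist_to_inf \<in> {W2_sq m, rel_entropy m, fisher_info m}"
  defines "S \<equiv> \<lambda>d. SUP x0 \<in> {x0 \<in> {..<d} \<rightarrow>\<^sub>E UNIV. enorm d x0 \<le> r * sqrt (real d)}.
                  dist_to_inf d (sol m d x0 (\<beta> * ln (real d)))"
  obtains K err where "K > 0" "err \<longlonglongrightarrow> 0"
    "eventually (\<lambda>d. ereal (K * real d powr (1 - 2 * \<beta>) - err d) \<le> S d) sequentially"
    "eventually (\<lambda>d. S d \<le> ereal (K * real d powr (1 - 2 * \<beta>) + err d)) sequentially"
proof
  let ?K = "if dist_to_inf = rel_entropy m then 1 / 2 else 1 :: real"
  let ?q = "\<lambda>d. exp (- (\<beta> * ln (real d)) / porous_medium.a m d)"
  let ?err = "\<lambda>d. porous_medium.error m d (?q d)"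
  show "?K * r\<^sup>2 > 0" using assms by simp
  show "?err \<longlonglongrightarrow> 0" using error_tendsto_0(2)[OF assms(1,3)] .
  have "eventually (\<lambda>d. ?q d < 1 / 2) sequentially"
    using error_tendsto_0(1)[OF assms(1,3)] by (rule order_tendstoD) simp
  then have "eventually (\<lambda>d. ereal (?K * r\<^sup>2 * real d powr (1 - 2 * \<beta>) - ?err d) \<le> S d
      \<and> S d \<le> ereal (?K * r\<^sup>2 * real d powr (1 - 2 * \<beta>) + ?err d)) sequentially"
    using eventually_ge_at_top[of 2]
  proof eventually_elim
    case (elim d)
    interpret porous_medium m d using assms elim by unfold_locales auto
    have t: "\<beta> * ln (real d) > 0" using elim assms(3) by simp
    have e: "exp (- 2 * (\<beta> * ln (real d))) * real d = real d powr (1 - 2 * \<beta>)"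
    proof -
      have "real d powr (- 2 * \<beta>) = exp (- 2 * (\<beta> * ln (real d)))"
        using elim by (simp add: powr_def)
      moreover have "real d powr (1 + - 2 * \<beta>) = real d * real d powr (- 2 * \<beta>)"
        using elim by (subst powr_add) simp
      ultimately show ?thesis by simp
    qed
    have "?K * (exp (- 2 * (\<beta> * ln (real d))) * (r\<^sup>2 * real d))
        = ?K * r\<^sup>2 * (exp (- 2 * (\<beta> * ln (real d))) * real d)"
      by (simp only: mult_ac)
    then have eq: "?K * (exp (- 2 * (\<beta> * ln (real d))) * (r\<^sup>2 * real d))
        = ?K * r\<^sup>2 * real d powr (1 - 2 * \<beta>)"
      unfolding e .
    show ?case
      using SUP_dist_sol_bounds[OF t _ assms(2,4) refl refl] elim(1)
      unfolding eq S_def by simp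
  qed
  then show "eventually (\<lambda>d. ereal (?K * r\<^sup>2 * real d powr (1 - 2 * \<beta>) - ?err d) \<le> S d) sequentially"
    "eventually (\<lambda>d. S d \<le> ereal (?K * r\<^sup>2 * real d powr (1 - 2 * \<beta>) + ?err d)) sequentially"
    by (auto elim: eventually_mono)
qed

theorem theorem1p2:
  fixes m r :: real
    and dist_to_inf :: "nat \<Rightarrow> ((nat \<Rightarrow> real) \<Rightarrow> real) \<Rightarrow> ereal"
  assumes "m > 1" and "r > 0"
    and "dist_to_inf \<in> {W2_sq m, rel_entropy m, fisher_info m}"
  shows "(\<forall>\<epsilon>. 0 < \<epsilon> \<and> \<epsilon> < 1 \<longrightarrow>
           (\<lambda>d. SUP x0 \<in> {x0 \<in> {..<d} \<rightarrow>\<^sub>E UNIV. enorm d x0 \<le> r * sqrt (real d)}.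
                  dist_to_inf d (sol m d x0 ((1 - \<epsilon>) * (1 / 2) * ln (real d))))
           \<longlonglongrightarrow> \<infinity>) \<and>
         (\<forall>\<epsilon>. 0 < \<epsilon> \<longrightarrow>
           (\<lambda>d. SUP x0 \<in> {x0 \<in> {..<d} \<rightarrow>\<^sub>E UNIV. enorm d x0 \<le> r * sqrt (real d)}.
                  dist_to_inf d (sol m d x0 ((1 + \<epsilon>) * (1 / 2) * ln (real d))))
           \<longlonglongrightarrow> 0)"
proof (intro conjI allI impI)
  fix \<epsilon> :: real assume \<epsilon>: "0 < \<epsilon> \<and> \<epsilon> < 1"
  then have "(1 - \<epsilon>) * (1 / 2) > 0" by simp
  from eventually_SUP_dist_sol_bounds[OF assms(1,2) this assms(3)]
  obtain K err where K: "K > 0" and err: "err \<longlonglongrightarrow> 0" and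
    lower: "eventually (\<lambda>d. ereal (K * real d powr (1 - 2 * ((1 - \<epsilon>) * (1 / 2))) - err d)
      \<le> (SUP x0 \<in> {x0 \<in> {..<d} \<rightarrow>\<^sub>E UNIV. enorm d x0 \<le> r * sqrt (real d)}.
                  dist_to_inf d (sol m d x0 ((1 - \<epsilon>) * (1 / 2) * ln (real d))))) sequentially"
    by blast
  have e: "1 - 2 * ((1 - \<epsilon>) * (1 / 2)) = \<epsilon>" by (simp add: field_simps)
  have "filterlim (\<lambda>d::nat. K * real d powr \<epsilon>) at_top sequentially"
    using K \<epsilon> by real_asymp
  then have "filterlim (\<lambda>d. - err d + K * real d powr \<epsilon>) at_top sequentially"
    using tendsto_minus[OF err] by (intro filterlim_tendsto_add_at_top)
  then have "filterlim (\<lambda>d. K * real d powr \<epsilon> - err d) at_top sequentially" by simp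
  then have lim: "(\<lambda>d. ereal (K * real d powr \<epsilon> - err d)) \<longlonglongrightarrow> \<infinity>"
    by (simp add: tendsto_PInfty_eq_at_top)
  show "(\<lambda>d. SUP x0 \<in> {x0 \<in> {..<d} \<rightarrow>\<^sub>E UNIV. enorm d x0 \<le> r * sqrt (real d)}.
                  dist_to_inf d (sol m d x0 ((1 - \<epsilon>) * (1 / 2) * ln (real d))))
           \<longlonglongrightarrow> \<infinity>"
    by (rule tendsto_sandwich[OF lower[unfolded e] _ lim tendsto_const]) simp
next
  fix \<epsilon> :: real assume \<epsilon>: "0 < \<epsilon>"
  then have "(1 + \<epsilon>) * (1 / 2) > 0" by simp
  from eventually_SUP_dist_sol_bounds[OF assms(1,2) this assms(3)]
  obtain K err where K: "K > 0" and err: "err \<longlonglongrightarrow> 0" and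
    lower: "eventually (\<lambda>d. ereal (K * real d powr (1 - 2 * ((1 + \<epsilon>) * (1 / 2))) - err d)
      \<le> (SUP x0 \<in> {x0 \<in> {..<d} \<rightarrow>\<^sub>E UNIV. enorm d x0 \<le> r * sqrt (real d)}.
                  dist_to_inf d (sol m d x0 ((1 + \<epsilon>) * (1 / 2) * ln (real d))))) sequentially" and
    upper: "eventually (\<lambda>d. (SUP x0 \<in> {x0 \<in> {..<d} \<rightarrow>\<^sub>E UNIV. enorm d x0 \<le> r * sqrt (real d)}.
                  dist_to_inf d (sol m d x0 ((1 + \<epsilon>) * (1 / 2) * ln (real d))))
      \<le> ereal (K * real d powr (1 - 2 * ((1 + \<epsilon>) * (1 / 2))) + err d)) sequentially"
    by blast
  have e: "1 - 2 * ((1 + \<epsilon>) * (1 / 2)) = - \<epsilon>" by (simp add: field_simps)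
  have main: "(\<lambda>d::nat. K * real d powr - \<epsilon>) \<longlonglongrightarrow> 0"
    using K \<epsilon> by real_asymp
  have lims: "(\<lambda>d. ereal (K * real d powr - \<epsilon> - err d)) \<longlonglongrightarrow> 0"
    "(\<lambda>d. ereal (K * real d powr - \<epsilon> + err d)) \<longlonglongrightarrow> 0"
    using tendsto_diff[OF main err] tendsto_add[OF main err] by (simp_all add: zero_ereal_def)
  show "(\<lambda>d. SUP x0 \<in> {x0 \<in> {..<d} \<rightarrow>\<^sub>E UNIV. enorm d x0 \<le> r * sqrt (real d)}.
                  dist_to_inf d (sol m d x0 ((1 + \<epsilon>) * (1 / 2) * ln (real d))))
           \<longlonglongrightarrow> 0"
    by (rule tendsto_sandwich[OF lower[unfolded e] upper[unfolded e] lims])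
qed

end
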